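(* Consider dynamical percolation on any infinite connected locally finite graph $G=(V,E)$ with possibly edge dependent probabilities $(p_e)_{e\in E}$, which percolates at a fixed time (that is, at a fixed time there is almost surely an infinite open cluster), and let $x\in V$. Let $I_x(e)$ denote the influence of the edge $e$ for the event $\{x\leftrightarrow\infty\}$. Assume that $$\sum_{e} I_x(e)<\infty .$$ Then almost surely the function $f(t):=\mathbf 1_{\{x\text{ percolates at time }t\}}$ is equal (Lebesgue-)almost everywhere to a function of bounded variation on $[0,1]$. Moreover, this implies that there are no exceptional times of nonpercolation, i.e. almost surely there is an infinite open cluster at every time $t$.
   Context: Static percolation: each edge $e$ is, independently of all others, open with probability $p_e$ and closed with probability $1-p_e$. $\{x\leftrightarrow\infty\}$ is the event that $x$ belongs to an infinite open cluster ("$x$ percolates"). An edge $e$ is pivotal for an event $A$ if changing the status of $e$ changes whether or not $A$ occurs; the influence of $e$ on $A$ is the probability (under static percolation) that $e$ is pivotal for $A$. Dynamical percolation: edges evolve independently as two-state continuous time Markov chains, edge $e$ switching from closed to open at rate $p_e$ and from open to closed at rate $1-p_e$, started from the stationary product measure. Convention: an edge is declared open at the times at which it changes state. "$x$ percolates at time $t$" means that $x$ is in an infinite open cluster in the configuration at time $t$.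
   Formalization: All edge probabilities are assumed to satisfy p_e > 0; with p_e = 0 allowed the claim fails: join x by two edges of probability 0 to a percolating graph that has exceptional times, so that all influences vanish. *)

theory Defs
  imports "HOL-Probability.Probability"
begin

text \<open>Simple undirected graphs: a vertex set \<open>V\<close> together with a set \<open>E\<close> of two-element
  subsets of \<open>V\<close>. A configuration is a function on edges, with \<open>True\<close> meaning open.\<close>

definition simple_graph :: "'v set \<Rightarrow> 'v set set \<Rightarrow> bool" where
  "simple_graph V E \<longleftrightarrow> (\<forall>e\<in>E. e \<subseteq> V \<and> card e = 2)"

definition locally_finite_graph :: "'v set \<Rightarrow> 'v set set \<Rightarrow> bool" where
  "locally_finite_graph V E \<longleftrightarrow> (\<forall>v\<in>V. finite {e \<in> E. v \<in> e})"

definition connected_graph :: "'v set \<Rightarrow> 'v set set \<Rightarrow> bool" where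
  "connected_graph V E \<longleftrightarrow> (\<forall>u\<in>V. \<forall>v\<in>V. (u, v) \<in> {(a, b). {a, b} \<in> E}\<^sup>*)"

definition open_cluster :: "'v set set \<Rightarrow> ('v set \<Rightarrow> bool) \<Rightarrow> 'v \<Rightarrow> 'v set" where
  "open_cluster E \<eta> x = {y. (x, y) \<in> {(a, b). {a, b} \<in> E \<and> \<eta> {a, b}}\<^sup>*}"

definition percolates :: "'v set set \<Rightarrow> ('v set \<Rightarrow> bool) \<Rightarrow> 'v \<Rightarrow> bool" where
  "percolates E \<eta> x \<longleftrightarrow> infinite (open_cluster E \<eta> x)"


definition static_percolation :: "'e set \<Rightarrow> ('e \<Rightarrow> real) \<Rightarrow> ('e \<Rightarrow> bool) measure" where
  "static_percolation E p = (\<Pi>\<^sub>M e\<in>E. measure_pmf (bernoulli_pmf (p e)))"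

definition pivotal :: "('e \<Rightarrow> bool) set \<Rightarrow> 'e \<Rightarrow> ('e \<Rightarrow> bool) \<Rightarrow> bool" where
  "pivotal A e \<eta> \<longleftrightarrow> (\<eta>(e := \<not> \<eta> e) \<in> A) \<noteq> (\<eta> \<in> A)"

definition influence :: "'e set \<Rightarrow> ('e \<Rightarrow> real) \<Rightarrow> ('e \<Rightarrow> bool) set \<Rightarrow> 'e \<Rightarrow> real" where
  "influence E p A e =
     measure (static_percolation E p) {\<eta> \<in> space (static_percolation E p). pivotal A e \<eta>}"

definition percolation_event ::
  "'v set set \<Rightarrow> ('v set \<Rightarrow> real) \<Rightarrow> 'v \<Rightarrow> ('v set \<Rightarrow> bool) set" where
  "percolation_event E p x = {\<eta> \<in> space (static_percolation E p). percolates E \<eta> x}"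


text \<open>\<open>P t s s'\<close> is the probability of going from \<open>s\<close> to \<open>s'\<close> in time \<open>t\<close>; the jump rates
  \<open>a\<close> (\<open>False\<close> to \<open>True\<close>) and \<open>b\<close> (\<open>True\<close> to \<open>False\<close>) are the off-diagonal entries of the
  derivative at time 0, i.e. of the generator, and determine \<open>P\<close> on nonnegative times.\<close>

definition transition_function ::
  "real \<Rightarrow> real \<Rightarrow> (real \<Rightarrow> bool \<Rightarrow> bool \<Rightarrow> real) \<Rightarrow> bool" where
  "transition_function a b P \<longleftrightarrow>
     (\<forall>t\<ge>0. \<forall>s s'. 0 \<le> P t s s') \<and>
     (\<forall>t\<ge>0. \<forall>s. (\<Sum>s'\<in>UNIV. P t s s') = 1) \<and>
     (\<forall>s s'. P 0 s s' = of_bool (s = s')) \<and>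
     (\<forall>t\<ge>0. \<forall>u\<ge>0. \<forall>s s''. P (t + u) s s'' = (\<Sum>s'\<in>UNIV. P t s s' * P u s' s'')) \<and>
     ((\<lambda>h. P h False True) has_real_derivative a) (at 0 within {0..}) \<and>
     ((\<lambda>h. P h True False) has_real_derivative b) (at 0 within {0..})"

text \<open>Sample paths on \<open>[0, \<infinity>)\<close> that have only isolated jumps (hence finitely many in bounded
  time) and are open at every jump time. Where the left and right values \<open>l\<close> and \<open>r\<close> agree, the
  value is the common one; where they differ, it is \<open>True\<close>.\<close>

definition open_at_jumps :: "(real \<Rightarrow> bool) \<Rightarrow> bool" where
  "open_at_jumps \<xi> \<longleftrightarrow>
     (\<forall>\<^sub>F s in at_right 0. \<xi> s = \<xi> 0) \<and>
     (\<forall>t>0. \<exists>l r. (\<forall>\<^sub>F s in at_left t. \<xi> s = l) \<and> (\<forall>\<^sub>F s in at_right t. \<xi> s = r) \<and>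
        \<xi> t = (l \<or> r))"

definition two_state_chain ::
  "'w measure \<Rightarrow> bool pmf \<Rightarrow> real \<Rightarrow> real \<Rightarrow> (real \<Rightarrow> 'w \<Rightarrow> bool) \<Rightarrow> bool" where
  "two_state_chain M \<mu> a b Y \<longleftrightarrow>
     (\<forall>t\<ge>0. Y t \<in> measurable M (count_space UNIV)) \<and>
     (\<exists>P. transition_function a b P \<and>
        (\<forall>n (t :: nat \<Rightarrow> real) (s :: nat \<Rightarrow> bool).
           t 0 = 0 \<and> (\<forall>i<n. t i \<le> t (Suc i)) \<longrightarrow>
           measure M {\<omega> \<in> space M. \<forall>i\<le>n. Y (t i) \<omega> = s i} =
             pmf \<mu> (s 0) * (\<Prod>i<n. P (t (Suc i) - t i) (s i) (s (Suc i))))) \<and>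
     (AE \<omega> in M. open_at_jumps (\<lambda>t. Y t \<omega>))"

text \<open>\<open>X e t \<omega>\<close> is the state of the edge \<open>e\<close> at time \<open>t\<close>; only \<open>e \<in> E\<close> and \<open>t \<ge> 0\<close> matter.
  Independence over the edges is that of the whole paths \<open>(X e t)\<close>, \<open>t \<ge> 0\<close>.\<close>

definition dynamical_percolation ::
  "'w measure \<Rightarrow> 'e set \<Rightarrow> ('e \<Rightarrow> real) \<Rightarrow> ('e \<Rightarrow> real \<Rightarrow> 'w \<Rightarrow> bool) \<Rightarrow> bool" where
  "dynamical_percolation M E p X \<longleftrightarrow>
     prob_space M \<and>
     (\<forall>e\<in>E. two_state_chain M (bernoulli_pmf (p e)) (p e) (1 - p e) (X e)) \<and>
     prob_space.indep_vars M (\<lambda>_. \<Pi>\<^sub>M t\<in>{0..}. count_space UNIV)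
       (\<lambda>e \<omega>. \<lambda>t\<in>{0..}. X e t \<omega>) E"


definition bounded_variation_on :: "real \<Rightarrow> real \<Rightarrow> (real \<Rightarrow> real) \<Rightarrow> bool" where
  "bounded_variation_on a b g \<longleftrightarrow>
     (\<exists>K. \<forall>n (t :: nat \<Rightarrow> real).
        (\<forall>i\<le>n. t i \<in> {a..b}) \<and> (\<forall>i<n. t i \<le> t (Suc i)) \<longrightarrow>
        (\<Sum>i<n. \<bar>g (t (Suc i)) - g (t i)\<bar>) \<le> K)"

end

theory Submission
  imports Defs
begin

text \<open>Write \<open>I\<close> for the influence of an edge on an observable \<open>\<phi>\<close> of the static configuration, i.e. the
  mean of \<open>\<bar>\<phi>(e open) - \<phi>(e closed)\<bar>\<close>. Replacing the edges of the configuration at time \<open>s\<close> by those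
  at time \<open>t\<close> one at a time gives \<open>E \<bar>\<phi>(t) - \<phi>(s)\<bar> \<le> \<bar>t - s\<bar> (\<Sum>e. I e)\<close>, so the expected variation of
  \<open>\<phi>\<close> along dyadic times in \<open>[0, L]\<close> is at most \<open>L (\<Sum>e. I e)\<close>. For \<open>\<phi>\<close> the indicator of
  \<open>x \<leftrightarrow> \<infinity>\<close> the limit along dyadic times is the required function of bounded variation.

  For the exceptional times, take instead \<open>\<phi>\<close> the probability of \<open>x \<leftrightarrow> \<infinity>\<close> when the edges of a
  large finite set \<open>F\<close> are resampled. Its influences vanish on \<open>F\<close> and do not exceed the original
  ones elsewhere, so the variation of \<open>\<phi>\<close> is bounded by the tail of a convergent series, while the
  value of \<open>\<phi>\<close> at a fixed time is close to \<open>\<theta> = P(x \<leftrightarrow> \<infinity>) > 0\<close> in \<open>L\<^sup>1\<close>. At an exceptional time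
  \<open>\<tau>\<close> no change of finitely many edges makes \<open>x\<close> percolate, and since edges are open when they
  jump, this persists at times near \<open>\<tau>\<close>; so \<open>\<phi>\<close> vanishes at some dyadic time, which by Markov's
  inequality has probability \<open>O(\<epsilon> / \<theta>)\<close>.\<close>

section \<open>Resampling one edge\<close>

text \<open>Overwriting coordinate \<open>i\<close> by an independent sample of law
  \<open>N i\<close> preserves the product measure; Fubini then lets that coordinate be integrated
  first.\<close>

lemma integral_PiM_resample:
  fixes g :: "('i \<Rightarrow> 'a) \<Rightarrow> real"
  assumes N: "\<And>i. i \<in> I \<Longrightarrow> prob_space (N i)" and i: "i \<in> I"
    and g[measurable]: "g \<in> borel_measurable (PiM I N)"
    and bnd: "\<And>\<omega>. \<bar>g \<omega>\<bar> \<le> B"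
  shows "(\<integral>\<omega>. g \<omega> \<partial>PiM I N) = (\<integral>w. (\<integral>x. g (w(i := x)) \<partial>N i) \<partial>PiM I N)"
proof -
  interpret Ni: prob_space "N i" using N i by auto
  interpret PiN: prob_space "PiM I N" using N by (intro prob_space_PiM) auto
  interpret pair_prob_space "N i" "PiM I N" ..
  have upd[measurable]: "(\<lambda>(x, X). X(i := x)) \<in> measurable (N i \<Otimes>\<^sub>M PiM I N) (PiM I N)"
    unfolding split_beta by (rule measurable_fun_upd[where J=I]) (use i in auto)
  have eq: "PiM I N = distr (N i \<Otimes>\<^sub>M PiM I N) (PiM I N) (\<lambda>(x, X). X(i := x))"
    using distr_pair_PiM_eq_PiM[of I N i] N i by (simp add: insert_absorb)
  have "(\<integral>\<omega>. g \<omega> \<partial>PiM I N) = (\<integral>z. g ((snd z)(i := fst z)) \<partial>(N i \<Otimes>\<^sub>M PiM I N))"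
    by (subst eq, subst integral_distr) (auto simp: split_beta)
  also have "\<dots> = (\<integral>w. (\<integral>x. g (w(i := x)) \<partial>N i) \<partial>PiM I N)"
  proof -
    have "(\<lambda>z. g ((snd z)(i := fst z))) \<in> borel_measurable (N i \<Otimes>\<^sub>M PiM I N)"
      using measurable_compose[OF upd g] by (simp add: split_beta)
    then have "integrable (N i \<Otimes>\<^sub>M PiM I N) (case_prod (\<lambda>x w. g (w(i := x))))"
      using bnd by (intro integrable_const_bound[where B=B]) (auto simp: split_beta)
    from integral_snd[OF this] show ?thesis by (simp add: case_prod_unfold)
  qed
  finally show ?thesis .
qed

section \<open>Observables of the static configuration and their influences\<close>

locale edge_percolation =
  fixes E :: "'e set" and p :: "'e \<Rightarrow> real"
  assumes p01: "\<And>e. e \<in> E \<Longrightarrow> 0 \<le> p e \<and> p e \<le> 1"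
begin

abbreviation \<mu> :: "('e \<Rightarrow> bool) measure" where "\<mu> \<equiv> static_percolation E p"

sublocale prob_space \<mu>
  unfolding static_percolation_def by (intro prob_space_PiM) (rule prob_space_measure_pmf)

lemma sets_static: "sets \<mu> = sets (\<Pi>\<^sub>M e\<in>E. count_space UNIV)"
  unfolding static_percolation_def by (intro sets_PiM_cong) auto

lemma space_static: "space \<mu> = extensional E"
  by (auto simp: static_percolation_def space_PiM PiE_def)

lemma measurable_static_update [measurable]:
  assumes "e \<in> E" shows "(\<lambda>\<eta>. \<eta>(e := b)) \<in> measurable \<mu> \<mu>"
  unfolding static_percolation_def
  by (rule measurable_fun_upd[where J=E]) (use assms in auto)

text \<open>The bounds hold at every function, also outside \<open>space \<mu>\<close>, so they
  apply to updated configurations without a check of extensionality.\<close>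

definition observable :: "(('e \<Rightarrow> bool) \<Rightarrow> real) \<Rightarrow> bool" where
  "observable \<phi> \<longleftrightarrow> \<phi> \<in> borel_measurable \<mu> \<and> (\<forall>\<eta>. 0 \<le> \<phi> \<eta> \<and> \<phi> \<eta> \<le> 1)"

lemma observableD:
  assumes "observable \<phi>"
  shows "\<phi> \<in> borel_measurable \<mu>" "0 \<le> \<phi> \<eta>" "\<phi> \<eta> \<le> 1" "\<bar>\<phi> \<eta>\<bar> \<le> 1" "\<bar>\<phi> \<eta> - \<phi> \<eta>'\<bar> \<le> 1"
proof -
  have *: "0 \<le> \<phi> \<eta> \<and> \<phi> \<eta> \<le> 1" for \<eta> using assms by (auto simp: observable_def)
  show "\<phi> \<in> borel_measurable \<mu>" using assms by (auto simp: observable_def)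
  show "0 \<le> \<phi> \<eta>" "\<phi> \<eta> \<le> 1" "\<bar>\<phi> \<eta>\<bar> \<le> 1" "\<bar>\<phi> \<eta> - \<phi> \<eta>'\<bar> \<le> 1"
    using *[of \<eta>] *[of \<eta>'] by auto
qed

definition edge_diff :: "'e \<Rightarrow> (('e \<Rightarrow> bool) \<Rightarrow> real) \<Rightarrow> ('e \<Rightarrow> bool) \<Rightarrow> real" where
  "edge_diff e \<phi> \<eta> = \<bar>\<phi> (\<eta>(e := True)) - \<phi> (\<eta>(e := False))\<bar>"

text \<open>Extends the influence from events to observables: for the indicator of an event,
  \<open>edge_diff e\<close> is the indicator that \<open>e\<close> is pivotal.\<close>

definition obs_influence :: "(('e \<Rightarrow> bool) \<Rightarrow> real) \<Rightarrow> 'e \<Rightarrow> real" where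
  "obs_influence \<phi> e = (\<integral>\<eta>. edge_diff e \<phi> \<eta> \<partial>\<mu>)"

text \<open>The conditional expectation of \<phi> under the static measure, given all edges other
  than \<open>e\<close>.\<close>

definition resample :: "'e \<Rightarrow> (('e \<Rightarrow> bool) \<Rightarrow> real) \<Rightarrow> ('e \<Rightarrow> bool) \<Rightarrow> real" where
  "resample e \<phi> \<eta> = \<phi> (\<eta>(e := True)) * p e + \<phi> (\<eta>(e := False)) * (1 - p e)"

lemma measurable_update:
  assumes "\<phi> \<in> borel_measurable \<mu>" "e \<in> E"
  shows "(\<lambda>\<eta>. \<phi> (\<eta>(e := b))) \<in> borel_measurable \<mu>"
  using measurable_compose[OF measurable_static_update[OF assms(2)] assms(1)] .

lemma integral_resample:
  assumes "\<phi> \<in> borel_measurable \<mu>" "e \<in> E" and "\<And>\<eta>. \<bar>\<phi> \<eta>\<bar> \<le> B"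
  shows "(\<integral>\<eta>. \<phi> \<eta> \<partial>\<mu>) = (\<integral>\<eta>. resample e \<phi> \<eta> \<partial>\<mu>)"
proof -
  have "(\<integral>\<eta>. \<phi> \<eta> \<partial>\<mu>) = (\<integral>\<eta>. (\<integral>x. \<phi> (\<eta>(e := x)) \<partial>measure_pmf (bernoulli_pmf (p e))) \<partial>\<mu>)"
    unfolding static_percolation_def
    using assms by (intro integral_PiM_resample[where B=B])
      (auto simp: prob_space_measure_pmf static_percolation_def)
  also have "\<dots> = (\<integral>\<eta>. resample e \<phi> \<eta> \<partial>\<mu>)"
    using p01[OF assms(2)] by (intro Bochner_Integration.integral_cong) (auto simp: resample_def)
  finally show ?thesis .
qed

lemma observable_resample:
  assumes "observable \<phi>" "e \<in> E"
  shows "observable (resample e \<phi>)"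
  unfolding observable_def
proof (intro conjI allI)
  note [measurable] = measurable_update[OF observableD(1)[OF assms(1)] assms(2)]
  show "resample e \<phi> \<in> borel_measurable \<mu>" unfolding resample_def by measurable
  fix \<eta>
  have p: "0 \<le> p e" "p e \<le> 1" using p01 assms by auto
  show "0 \<le> resample e \<phi> \<eta>" unfolding resample_def using p observableD(2)[OF assms(1)] by auto
  have "resample e \<phi> \<eta> \<le> 1 * p e + 1 * (1 - p e)"
    unfolding resample_def using p observableD(3)[OF assms(1)]
    by (intro add_mono mult_right_mono) auto
  then show "resample e \<phi> \<eta> \<le> 1" by simp
qed

lemma measurable_edge_diff:
  assumes "observable \<phi>" "e \<in> E"
  shows "edge_diff e \<phi> \<in> borel_measurable \<mu>"
proof -
  note [measurable] = measurable_update[OF observableD(1)[OF assms(1)] assms(2)]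
  show ?thesis unfolding edge_diff_def by measurable
qed

lemma edge_diff_bounds:
  assumes "observable \<phi>" shows "0 \<le> edge_diff e \<phi> \<eta>" "edge_diff e \<phi> \<eta> \<le> 1"
  using observableD(5)[OF assms] by (auto simp: edge_diff_def)

lemma observable_edge_diff:
  assumes "observable \<phi>" "e \<in> E" shows "observable (edge_diff e \<phi>)"
  using measurable_edge_diff[OF assms] edge_diff_bounds[OF assms(1)] by (auto simp: observable_def)

lemma integrable_observable:
  assumes "observable \<phi>" shows "integrable \<mu> \<phi>"
  using assms by (intro integrable_const_bound[where B=1]) (auto simp: observable_def)

lemma obs_influence_nonneg: "0 \<le> obs_influence \<phi> e"
  unfolding obs_influence_def by (intro Bochner_Integration.integral_nonneg) (simp add: edge_diff_def)

lemma edge_diff_resample_same: "edge_diff e (resample e \<phi>) \<eta> = 0"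
  by (simp add: edge_diff_def resample_def)

lemma obs_influence_resample_same: "obs_influence (resample e \<phi>) e = 0"
  by (simp add: obs_influence_def edge_diff_resample_same)

text \<open>Updates at distinct edges commute, so the difference at \<open>e'\<close> of an average
  over \<open>e\<close> is the average of the differences, and the triangle inequality bounds its
  modulus. Averaging over \<open>e\<close> keeps the integral. For \<open>e = e'\<close> the
  influence becomes 0.\<close>

lemma obs_influence_resample_le:
  assumes \<phi>: "observable \<phi>" and e: "e \<in> E" "e' \<in> E"
  shows "obs_influence (resample e \<phi>) e' \<le> obs_influence \<phi> e'"
proof (cases "e = e'")
  case True
  then show ?thesis by (simp add: obs_influence_resample_same obs_influence_nonneg)
next
  case False
  have p: "0 \<le> p e" "p e \<le> 1" using p01 e by auto
  have "obs_influence (resample e \<phi>) e' \<le> (\<integral>\<eta>. resample e (edge_diff e' \<phi>) \<eta> \<partial>\<mu>)"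
    unfolding obs_influence_def
  proof (intro integral_mono integrable_observable observable_edge_diff observable_resample \<phi> e)
    fix \<eta>
    let ?a = "\<phi> (\<eta>(e' := True, e := True)) - \<phi> (\<eta>(e' := False, e := True))"
    let ?b = "\<phi> (\<eta>(e' := True, e := False)) - \<phi> (\<eta>(e' := False, e := False))"
    have "edge_diff e' (resample e \<phi>) \<eta> = \<bar>?a * p e + ?b * (1 - p e)\<bar>"
      by (simp add: edge_diff_def resample_def algebra_simps)
    also have "\<dots> \<le> \<bar>?a\<bar> * p e + \<bar>?b\<bar> * (1 - p e)"
      using p by (intro order_trans[OF abs_triangle_ineq]) (simp add: abs_mult)
    also have "\<dots> = resample e (edge_diff e' \<phi>) \<eta>"
      using False by (simp add: edge_diff_def resample_def fun_upd_twist)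
    finally show "edge_diff e' (resample e \<phi>) \<eta> \<le> resample e (edge_diff e' \<phi>) \<eta>" .
  qed
  also have "\<dots> = obs_influence \<phi> e'"
    unfolding obs_influence_def using observable_edge_diff[OF \<phi> e(2)] e
    by (intro integral_resample[symmetric, where B=1] observableD)
  finally show ?thesis .
qed

text \<open>A conditional expectation is an L1 contraction.\<close>

lemma integral_resample_dist_le:
  assumes \<phi>: "observable \<phi>" and \<psi>: "observable \<psi>" and e: "e \<in> E"
  shows "(\<integral>\<eta>. \<bar>resample e \<phi> \<eta> - resample e \<psi> \<eta>\<bar> \<partial>\<mu>) \<le> (\<integral>\<eta>. \<bar>\<phi> \<eta> - \<psi> \<eta>\<bar> \<partial>\<mu>)"
proof -
  have p: "0 \<le> p e" "p e \<le> 1" using p01 e by auto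
  have obs: "observable (\<lambda>\<eta>. \<bar>\<phi> \<eta> - \<psi> \<eta>\<bar>)" if "observable \<phi>" "observable \<psi>" for \<phi> \<psi>
  proof -
    have "\<bar>\<phi> \<eta> - \<psi> \<eta>\<bar> \<le> 1" for \<eta> 
      using observableD(2,3)[OF that(1), of \<eta>] observableD(2,3)[OF that(2), of \<eta>] by auto
    then show ?thesis using observableD(1)[OF that(1)] observableD(1)[OF that(2)]
      by (auto simp: observable_def)
  qed
  have "(\<integral>\<eta>. \<bar>resample e \<phi> \<eta> - resample e \<psi> \<eta>\<bar> \<partial>\<mu>) \<le> (\<integral>\<eta>. resample e (\<lambda>\<eta>. \<bar>\<phi> \<eta> - \<psi> \<eta>\<bar>) \<eta> \<partial>\<mu>)"
  proof (intro integral_mono integrable_observable obs observable_resample \<phi> \<psi> e)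
    fix \<eta>
    let ?a = "\<phi> (\<eta>(e := True)) - \<psi> (\<eta>(e := True))"
    let ?b = "\<phi> (\<eta>(e := False)) - \<psi> (\<eta>(e := False))"
    have "\<bar>resample e \<phi> \<eta> - resample e \<psi> \<eta>\<bar> = \<bar>?a * p e + ?b * (1 - p e)\<bar>"
      by (simp add: resample_def algebra_simps)
    also have "\<dots> \<le> \<bar>?a\<bar> * p e + \<bar>?b\<bar> * (1 - p e)"
      using p by (intro order_trans[OF abs_triangle_ineq]) (simp add: abs_mult)
    finally show "\<bar>resample e \<phi> \<eta> - resample e \<psi> \<eta>\<bar> \<le> resample e (\<lambda>\<eta>. \<bar>\<phi> \<eta> - \<psi> \<eta>\<bar>) \<eta>"
      by (simp add: resample_def)
  qed
  also have "\<dots> = (\<integral>\<eta>. \<bar>\<phi> \<eta> - \<psi> \<eta>\<bar> \<partial>\<mu>)"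
    using observableD[OF obs[OF \<phi> \<psi>]] e by (intro integral_resample[symmetric, where B=1]) auto
  finally show ?thesis .
qed

section \<open>Approximation by functions of finitely many edges\<close>

definition depends_on :: "'e set \<Rightarrow> (('e \<Rightarrow> bool) \<Rightarrow> real) \<Rightarrow> bool" where
  "depends_on F \<psi> \<longleftrightarrow> (\<forall>\<eta>\<in>space \<mu>. \<forall>\<eta>'\<in>space \<mu>. (\<forall>e\<in>F. \<eta> e = \<eta>' e) \<longrightarrow> \<psi> \<eta> = \<psi> \<eta>')"

text \<open>Approximability in L1 by functions of finitely many edges. It is verified for
  \<open>perc x\<close> through finite cuts and handed on by resampling.\<close>

definition locally_approximable :: "(('e \<Rightarrow> bool) \<Rightarrow> real) \<Rightarrow> bool" where
  "locally_approximable \<phi> \<longleftrightarrow> (\<forall>\<epsilon>>0. \<exists>F \<psi>. finite F \<and> F \<subseteq> E \<and> observable \<psi> \<and> depends_on F \<psi> \<and>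
     (\<integral>\<eta>. \<bar>\<phi> \<eta> - \<psi> \<eta>\<bar> \<partial>\<mu>) < \<epsilon>)"

lemma update_in_space: "\<eta> \<in> space \<mu> \<Longrightarrow> e \<in> E \<Longrightarrow> \<eta>(e := b) \<in> space \<mu>"
  by (auto simp: space_static extensional_def)

lemma depends_on_resample:
  assumes "depends_on F \<psi>" "e \<in> E" shows "depends_on (F - {e}) (resample e \<psi>)"
  unfolding depends_on_def
proof (intro ballI impI)
  fix \<eta> \<eta>' assume \<eta>: "\<eta> \<in> space \<mu>" "\<eta>' \<in> space \<mu>" "\<forall>e'\<in>F - {e}. \<eta> e' = \<eta>' e'"
  have "\<psi> (\<eta>(e := b)) = \<psi> (\<eta>'(e := b))" for b
  proof -
    have "\<forall>e'\<in>F. (\<eta>(e := b)) e' = (\<eta>'(e := b)) e'" using \<eta>(3) by auto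
    then show ?thesis
      using assms(1) update_in_space[OF \<eta>(1) assms(2)] update_in_space[OF \<eta>(2) assms(2)]
      unfolding depends_on_def by blast
  qed
  then show "resample e \<psi> \<eta> = resample e \<psi> \<eta>'" by (simp only: resample_def)
qed

text \<open>Resampling the approximant along with \<phi> does not increase the L1 error.\<close>

lemma locally_approximable_resample:
  assumes "locally_approximable \<phi>" "observable \<phi>" "e \<in> E"
  shows "locally_approximable (resample e \<phi>)"
  unfolding locally_approximable_def
proof (intro allI impI)
  fix \<epsilon> :: real assume "0 < \<epsilon>"
  then obtain F \<psi> where F: "finite F" "F \<subseteq> E" "observable \<psi>" "depends_on F \<psi>"
    "(\<integral>\<eta>. \<bar>\<phi> \<eta> - \<psi> \<eta>\<bar> \<partial>\<mu>) < \<epsilon>"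
    using assms(1)[unfolded locally_approximable_def, rule_format, OF \<open>0 < \<epsilon>\<close>] by (elim exE conjE)
  show "\<exists>F \<psi>. finite F \<and> F \<subseteq> E \<and> observable \<psi> \<and> depends_on F \<psi> \<and>
     (\<integral>\<eta>. \<bar>resample e \<phi> \<eta> - \<psi> \<eta>\<bar> \<partial>\<mu>) < \<epsilon>"
  proof (intro exI conjI)
    show "finite (F - {e})" "F - {e} \<subseteq> E" using F(1,2) by auto
    show "(\<integral>\<eta>. \<bar>resample e \<phi> \<eta> - resample e \<psi> \<eta>\<bar> \<partial>\<mu>) < \<epsilon>"
      using integral_resample_dist_le[OF assms(2) F(3) assms(3)] F(5) by (rule le_less_trans)
  qed (rule observable_resample[OF F(3) assms(3)] depends_on_resample[OF F(4) assms(3)])+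
qed

section \<open>Resampling finitely many edges\<close>

definition resample_list :: "'e list \<Rightarrow> (('e \<Rightarrow> bool) \<Rightarrow> real) \<Rightarrow> ('e \<Rightarrow> bool) \<Rightarrow> real" where
  "resample_list es \<phi> = foldr resample es \<phi>"

lemma resample_list_simps [simp]:
  "resample_list [] \<phi> = \<phi>" "resample_list (e # es) \<phi> = resample e (resample_list es \<phi>)"
  by (simp_all add: resample_list_def)

text \<open>Only \<open>set es\<close> enters the conclusions, so the order of the list and
  repetitions in it are harmless.\<close>

lemma resample_list_props:
  assumes "observable \<phi>" "set es \<subseteq> E"
  shows "observable (resample_list es \<phi>)"
    and "locally_approximable \<phi> \<Longrightarrow> locally_approximable (resample_list es \<phi>)"
    and "e' \<in> E \<Longrightarrow> obs_influence (resample_list es \<phi>) e' \<le> (if e' \<in> set es then 0 else obs_influence \<phi> e')"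
    and "(\<integral>\<eta>. resample_list es \<phi> \<eta> \<partial>\<mu>) = (\<integral>\<eta>. \<phi> \<eta> \<partial>\<mu>)"
    and "depends_on F \<phi> \<Longrightarrow> depends_on (F - set es) (resample_list es \<phi>)"
proof -
  \<comment> \<open>The claims go into one induction because the one-edge lemmas need observability
    of the function resampled so far.\<close>
  have "observable (resample_list es \<phi>) \<and> (locally_approximable \<phi> \<longrightarrow> locally_approximable (resample_list es \<phi>)) \<and>
     (e' \<in> E \<longrightarrow> obs_influence (resample_list es \<phi>) e' \<le> (if e' \<in> set es then 0 else obs_influence \<phi> e')) \<and>
     (\<integral>\<eta>. resample_list es \<phi> \<eta> \<partial>\<mu>) = (\<integral>\<eta>. \<phi> \<eta> \<partial>\<mu>) \<and> (depends_on F \<phi> \<longrightarrow> depends_on (F - set es) (resample_list es \<phi>))"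
    using assms(2)
  proof (induction es)
    case Nil
    then show ?case using assms(1) by simp
  next
    case (Cons e es)
    then have e: "e \<in> E" and IH: "observable (resample_list es \<phi>)"
      "locally_approximable \<phi> \<Longrightarrow> locally_approximable (resample_list es \<phi>)"
      "e' \<in> E \<Longrightarrow> obs_influence (resample_list es \<phi>) e' \<le> (if e' \<in> set es then 0 else obs_influence \<phi> e')"
      "(\<integral>\<eta>. resample_list es \<phi> \<eta> \<partial>\<mu>) = (\<integral>\<eta>. \<phi> \<eta> \<partial>\<mu>)" "depends_on F \<phi> \<Longrightarrow> depends_on (F - set es) (resample_list es \<phi>)"
      by auto
    have 3: "obs_influence (resample e (resample_list es \<phi>)) e' \<le> (if e' \<in> set (e # es) then 0 else obs_influence \<phi> e')"
      if "e' \<in> E"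
      using obs_influence_resample_le[OF IH(1) e that] IH(3)[OF that] obs_influence_resample_same[of e]
      by (cases "e = e'") (auto simp: obs_influence_resample_same)
    have 4: "(\<integral>\<eta>. resample e (resample_list es \<phi>) \<eta> \<partial>\<mu>) = (\<integral>\<eta>. \<phi> \<eta> \<partial>\<mu>)"
      using integral_resample[OF observableD(1)[OF IH(1)] e observableD(4)[OF IH(1)]] IH(4) by simp
    have 5: "depends_on (F - set (e # es)) (resample e (resample_list es \<phi>))" if "depends_on F \<phi>"
    proof -
      have "F - set (e # es) = F - set es - {e}" by auto
      then show ?thesis using depends_on_resample[OF IH(5)[OF that] e] by (simp only:)
    qed
    show ?case
      using 3 4 5 observable_resample[OF IH(1) e] locally_approximable_resample[OF IH(2) IH(1) e] by simp
  qed
  then show "observable (resample_list es \<phi>)"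
    and "locally_approximable \<phi> \<Longrightarrow> locally_approximable (resample_list es \<phi>)"
    and "e' \<in> E \<Longrightarrow> obs_influence (resample_list es \<phi>) e' \<le> (if e' \<in> set es then 0 else obs_influence \<phi> e')"
    and "(\<integral>\<eta>. resample_list es \<phi> \<eta> \<partial>\<mu>) = (\<integral>\<eta>. \<phi> \<eta> \<partial>\<mu>)"
    and "depends_on F \<phi> \<Longrightarrow> depends_on (F - set es) (resample_list es \<phi>)"
    by auto
qed

lemma integral_resample_list_dist_le:
  assumes "observable \<phi>" "observable \<psi>" "set es \<subseteq> E"
  shows "(\<integral>\<eta>. \<bar>resample_list es \<phi> \<eta> - resample_list es \<psi> \<eta>\<bar> \<partial>\<mu>) \<le> (\<integral>\<eta>. \<bar>\<phi> \<eta> - \<psi> \<eta>\<bar> \<partial>\<mu>)"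
  using assms(3)
proof (induction es)
  case (Cons e es)
  have e: "e \<in> E" "set es \<subseteq> E" using Cons.prems by auto
  show ?case
    unfolding resample_list_simps
    using integral_resample_dist_le[OF resample_list_props(1)[OF assms(1) e(2)]
        resample_list_props(1)[OF assms(2) e(2)] e(1)] Cons.IH[OF e(2)]
    by (rule order_trans)
next
  case Nil
  show ?case by (simp only: resample_list_simps)
qed

lemma depends_on_empty_eq_integral:
  assumes "depends_on {} \<psi>" "\<eta> \<in> space \<mu>"
  shows "\<psi> \<eta> = (\<integral>\<eta>. \<psi> \<eta> \<partial>\<mu>)"
proof -
  have "(\<integral>\<eta>'. \<psi> \<eta>' \<partial>\<mu>) = (\<integral>\<eta>'. \<psi> \<eta> \<partial>\<mu>)"
  proof (rule Bochner_Integration.integral_cong[OF refl])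
    fix \<eta>' assume "\<eta>' \<in> space \<mu>"
    with assms show "\<psi> \<eta>' = \<psi> \<eta>" unfolding depends_on_def by blast
  qed
  then show ?thesis by (simp add: prob_space)
qed

text \<open>Take \<open>F\<close> to carry an approximant \<psi> with error below \<epsilon>/2.
  Resampling all of \<open>F\<close> turns \<psi> into the constant equal to its mean. By
  contraction the resampled \<phi> is within \<epsilon>/2 of that constant in L1, and the two means
  differ by less than \<epsilon>/2.\<close>

lemma resample_list_concentrates:
  assumes \<phi>: "observable \<phi>" "locally_approximable \<phi>" and "0 < \<epsilon>"
  obtains F where "finite F" "F \<subseteq> E"
    "\<And>es. F \<subseteq> set es \<Longrightarrow> set es \<subseteq> E \<Longrightarrow>
      (\<integral>\<eta>. \<bar>resample_list es \<phi> \<eta> - (\<integral>\<eta>. \<phi> \<eta> \<partial>\<mu>)\<bar> \<partial>\<mu>) < \<epsilon>"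
proof -
  obtain F \<psi> where F: "finite F" "F \<subseteq> E" "observable \<psi>" "depends_on F \<psi>"
    "(\<integral>\<eta>. \<bar>\<phi> \<eta> - \<psi> \<eta>\<bar> \<partial>\<mu>) < \<epsilon> / 2"
    using assms(2)[unfolded locally_approximable_def, rule_format, OF half_gt_zero[OF \<open>0 < \<epsilon>\<close>]]
    by (elim exE conjE)
  show ?thesis
  proof (rule that[of F])
    fix es assume es: "F \<subseteq> set es" "set es \<subseteq> E"
    note obs = resample_list_props(1)[OF \<phi>(1) es(2)] resample_list_props(1)[OF F(3) es(2)]
    note [measurable] = observableD(1)[OF \<phi>(1)] observableD(1)[OF F(3)] observableD(1)[OF obs(1)] observableD(1)[OF obs(2)]
    have int[simp]: "integrable \<mu> \<phi>" "integrable \<mu> \<psi>" "integrable \<mu> (resample_list es \<phi>)" "integrable \<mu> (resample_list es \<psi>)"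
      using \<phi>(1) F(3) obs by (auto intro: integrable_observable)
    have "depends_on {} (resample_list es \<psi>)"
      using resample_list_props(5)[OF F(3) es(2) F(4)] es(1) by (simp add: Diff_eq_empty_iff[THEN iffD2])
    then have const: "resample_list es \<psi> \<eta> = (\<integral>\<eta>. \<psi> \<eta> \<partial>\<mu>)" if "\<eta> \<in> space \<mu>" for \<eta>
      using depends_on_empty_eq_integral[OF _ that] resample_list_props(4)[OF F(3) es(2)] by simp
    let ?d = "\<bar>(\<integral>\<eta>. \<psi> \<eta> \<partial>\<mu>) - (\<integral>\<eta>. \<phi> \<eta> \<partial>\<mu>)\<bar>"
    have d: "?d \<le> (\<integral>\<eta>. \<bar>\<phi> \<eta> - \<psi> \<eta>\<bar> \<partial>\<mu>)"
      using integral_abs_bound[of \<mu> "\<lambda>\<eta>. \<phi> \<eta> - \<psi> \<eta>"] by (simp add: abs_minus_commute)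
    have "(\<integral>\<eta>. \<bar>resample_list es \<phi> \<eta> - (\<integral>\<eta>. \<phi> \<eta> \<partial>\<mu>)\<bar> \<partial>\<mu>)
        \<le> (\<integral>\<eta>. \<bar>resample_list es \<phi> \<eta> - resample_list es \<psi> \<eta>\<bar> + ?d \<partial>\<mu>)"
      by (intro integral_mono) (auto simp: const)
    also have "\<dots> = (\<integral>\<eta>. \<bar>resample_list es \<phi> \<eta> - resample_list es \<psi> \<eta>\<bar> \<partial>\<mu>) + ?d"
      by (simp add: prob_space)
    also have "\<dots> < \<epsilon>"
      using d F(5) integral_resample_list_dist_le[OF \<phi>(1) F(3) es(2)] by linarith
    finally show "(\<integral>\<eta>. \<bar>resample_list es \<phi> \<eta> - (\<integral>\<eta>. \<phi> \<eta> \<partial>\<mu>)\<bar> \<partial>\<mu>) < \<epsilon>" .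
  qed (use F in auto)
qed

end

section \<open>Two coupled configurations\<close>

context edge_percolation
begin

text \<open>Independence together with the marginal laws identifies the joint law as a product;
  applied to hybrids of two configurations.\<close>

lemma distr_eq_static:
  assumes M: "prob_space M" and ne: "E \<noteq> {}"
    and ind: "prob_space.indep_vars M (\<lambda>_. count_space UNIV) H E"
    and marg: "\<And>e. e \<in> E \<Longrightarrow> distr M (count_space UNIV) (H e) = measure_pmf (bernoulli_pmf (p e))"
  shows "distr M \<mu> (\<lambda>w. \<lambda>e\<in>E. H e w) = \<mu>"
proof -
  interpret M: prob_space M by fact
  have rv: "H e \<in> measurable M (count_space UNIV)" if "e \<in> E" for e
    using ind that by (auto simp: M.indep_vars_def)
  have "distr M \<mu> (\<lambda>w. \<lambda>e\<in>E. H e w) = distr M (\<Pi>\<^sub>M e\<in>E. count_space UNIV) (\<lambda>w. \<lambda>e\<in>E. H e w)"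
    by (intro distr_cong) (auto simp: sets_static)
  also have "\<dots> = (\<Pi>\<^sub>M e\<in>E. distr M (count_space UNIV) (H e))"
    using M.indep_vars_iff_distr_eq_PiM'[OF ne, where M'="\<lambda>_. count_space UNIV" and X=H] rv ind by simp
  also have "\<dots> = \<mu>"
    unfolding static_percolation_def by (intro PiM_cong) (auto simp: marg)
  finally show ?thesis .
qed

lemma measurable_config:
  assumes "\<And>e. e \<in> E \<Longrightarrow> H e \<in> measurable M (count_space UNIV)"
  shows "(\<lambda>w. \<lambda>e\<in>E. H e w) \<in> measurable M \<mu>"
  unfolding measurable_cong_sets[OF refl sets_static] using assms by (rule measurable_restrict)

end

text \<open>Independence is over edges only: \<open>Y e\<close> and \<open>Z e\<close> may depend on
  each other. For dynamical percolation they are the states at times \<open>s \<le> t\<close>, with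
  the same \<open>q = t - s\<close> for every edge.\<close>

locale coupled_configurations = edge_percolation E p + M: prob_space M
  for E :: "'e set" and p :: "'e \<Rightarrow> real" and M :: "'w measure" +
  fixes Y Z :: "'e \<Rightarrow> 'w \<Rightarrow> bool" and q :: real
  assumes E_nonempty: "E \<noteq> {}"
    and indep: "M.indep_vars (\<lambda>_. count_space UNIV) (\<lambda>e w. (Y e w, Z e w)) E"
    and Y_law: "\<And>e. e \<in> E \<Longrightarrow> distr M (count_space UNIV) (Y e) = measure_pmf (bernoulli_pmf (p e))"
    and Z_law: "\<And>e. e \<in> E \<Longrightarrow> distr M (count_space UNIV) (Z e) = measure_pmf (bernoulli_pmf (p e))"
    and change: "\<And>e. e \<in> E \<Longrightarrow> measure M {w \<in> space M. Y e w \<noteq> Z e w} \<le> q"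
    and q_nonneg: "0 \<le> q"
begin

text \<open>Interpolates between the configuration \<open>Y\<close> at \<open>F = {}\<close> and the
  configuration \<open>Z\<close> at \<open>F = E\<close>.\<close>

definition hybrid :: "'e set \<Rightarrow> 'w \<Rightarrow> 'e \<Rightarrow> bool" where
  "hybrid F w = (\<lambda>e\<in>E. if e \<in> F then Z e w else Y e w)"

lemma pair_measurable:
  assumes "e \<in> E" shows "(\<lambda>w. (Y e w, Z e w)) \<in> measurable M (count_space UNIV)"
  using indep assms by (auto simp: M.indep_vars_def)

text \<open>Each edge contributes only one entry of its pair, so neither independence over edges nor
  the Bernoulli marginals are affected by the dependence between \<open>Y e\<close> and
  \<open>Z e\<close>.\<close>

lemma hybrid_law: "distr M \<mu> (hybrid F) = \<mu>"
  unfolding hybrid_def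
proof (rule distr_eq_static[OF M.prob_space_axioms E_nonempty])
  have "M.indep_vars (\<lambda>_. count_space UNIV)
      (\<lambda>e w. (\<lambda>e x. if e \<in> F then snd x else fst x) e (Y e w, Z e w)) E"
    by (rule M.indep_vars_compose2[OF indep]) simp
  then show "M.indep_vars (\<lambda>_. count_space UNIV) (\<lambda>e w. if e \<in> F then Z e w else Y e w) E"
    by (simp only: fst_conv snd_conv)
  fix e assume "e \<in> E"
  then show "distr M (count_space UNIV) (\<lambda>w. if e \<in> F then Z e w else Y e w)
      = measure_pmf (bernoulli_pmf (p e))"
    using Y_law Z_law by (cases "e \<in> F") auto
qed

lemma hybrid_measurable [measurable]: "hybrid F \<in> measurable M \<mu>"
proof -
  have "(\<lambda>w. if e \<in> F then Z e w else Y e w) \<in> measurable M (count_space UNIV)" if "e \<in> E" for e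
    using measurable_compose[OF pair_measurable[OF that],
        where g="\<lambda>x. if e \<in> F then snd x else fst x" and L="count_space UNIV"]
    by (simp only: fst_conv snd_conv measurable_count_space_eq1 UNIV_I Pi_UNIV space_count_space simp_thms)
  from measurable_config[OF this] show ?thesis by (simp add: hybrid_def[abs_def])
qed

lemma integral_hybrid:
  fixes \<phi> :: "_ \<Rightarrow> real"
  assumes "\<phi> \<in> borel_measurable \<mu>"
  shows "(\<integral>w. \<phi> (hybrid F w) \<partial>M) = (\<integral>\<eta>. \<phi> \<eta> \<partial>\<mu>)"
  using integral_distr[OF hybrid_measurable assms, of F] by (simp add: hybrid_law)

lemma integrable_hybrid:
  assumes "observable \<phi>" shows "integrable M (\<lambda>w. \<phi> (hybrid F w))"
  using measurable_compose[OF hybrid_measurable observableD(1)[OF assms]] observableD(4)[OF assms]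
  by (intro M.integrable_const_bound[where B=1]) auto

text \<open>The two hybrids differ at most at \<open>e\<close>, and only if \<open>Y e\<close> and
  \<open>Z e\<close> differ; the change of \<phi> is then \<open>edge_diff e \<phi>\<close>. That
  quantity ignores the state of \<open>e\<close>, hence is independent of the pair at
  \<open>e\<close>, and its mean under the static law of the hybrid is the influence.\<close>

lemma hybrid_step:
  assumes \<phi>: "observable \<phi>" and e: "e \<in> E" "e \<notin> F"
  shows "(\<integral>w. \<bar>\<phi> (hybrid F w) - \<phi> (hybrid (insert e F) w)\<bar> \<partial>M) \<le> q * obs_influence \<phi> e"
proof -
  \<comment> \<open>\<open>K e\<close> is the law of the pair at \<open>e\<close>, and
    \<open>W\<close> has law \<open>PiM E K\<close>; writing both hybrids as functions of
    \<open>W\<close> allows the pair at \<open>e\<close> to be integrated out first.\<close>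
  define K where "K = (\<lambda>e. distr M (count_space UNIV) (\<lambda>w. (Y e w, Z e w)))"
  define W where "W w = (\<lambda>e\<in>E. (Y e w, Z e w))" for w
  define h where "h F U = (\<lambda>e\<in>E. if e \<in> F then snd (U e) else fst (U e))"
    for F and U :: "'e \<Rightarrow> bool \<times> bool"
  define g where "g U = \<bar>\<phi> (h F U) - \<phi> (h (insert e F) U)\<bar>" for U
  have hW: "h F (W w) = hybrid F w" for F w
    by (auto simp: h_def W_def hybrid_def)
  have K: "prob_space (K e)" if "e \<in> E" for e
    unfolding K_def using pair_measurable[OF that] by (rule M.prob_space_distr)
  have W_meas: "W \<in> measurable M (PiM E K)"
    unfolding W_def by (rule measurable_restrict) (use pair_measurable in \<open>auto simp: K_def\<close>)
  have sets_K: "sets (PiM E K) = sets (\<Pi>\<^sub>M e\<in>E. count_space UNIV)"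
    by (intro sets_PiM_cong) (auto simp: K_def)
  have W_law: "distr M (PiM E K) W = PiM E K"
  proof -
    have "distr M (PiM E K) W = distr M (\<Pi>\<^sub>M e\<in>E. count_space UNIV) W"
      by (intro distr_cong) (auto simp: sets_K)
    also have "\<dots> = PiM E K"
      using M.indep_vars_iff_distr_eq_PiM'[OF E_nonempty, where M'="\<lambda>_. count_space UNIV"
          and X="\<lambda>e w. (Y e w, Z e w)"] pair_measurable indep
      by (simp add: W_def[abs_def] K_def)
    finally show ?thesis .
  qed
  have h_meas: "h F \<in> measurable (PiM E K) \<mu>" for F
  proof -
    have "(\<lambda>U. if e \<in> F then snd (U e) else fst (U e)) \<in> measurable (PiM E K) (count_space UNIV)"
      if "e \<in> E" for e
    proof -
      have "(\<lambda>U. U e) \<in> measurable (PiM E K) (count_space UNIV)"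
        using measurable_component_singleton[OF that, of K] by (simp add: K_def)
      from measurable_compose[OF this,
          where g="\<lambda>x. if e \<in> F then snd x else fst x" and L="count_space UNIV"]
      show ?thesis by simp
    qed
    from measurable_config[OF this] show ?thesis by (simp add: h_def[abs_def])
  qed
  have g_meas: "g \<in> borel_measurable (PiM E K)"
    unfolding g_def[abs_def]
    using measurable_compose[OF h_meas observableD(1)[OF \<phi>]] by measurable
  have d_meas: "(\<lambda>U. edge_diff e \<phi> (h F U)) \<in> borel_measurable (PiM E K)"
    using measurable_compose[OF h_meas measurable_edge_diff[OF \<phi> e(1)]] .
  \<comment> \<open>With the pair at \<open>e\<close> set to \<open>x\<close>, the two hybrids carry
    \<open>fst x\<close> and \<open>snd x\<close> at \<open>e\<close> and agree elsewhere, so the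
    integrand factorises.\<close>
  have g_upd: "g (U(e := x)) = of_bool (fst x \<noteq> snd x) * edge_diff e \<phi> (h F U)" for U x
  proof -
    have "h F (U(e := x)) = (h F U)(e := fst x)" "h (insert e F) (U(e := x)) = (h F U)(e := snd x)"
      using e by (auto simp: h_def fun_eq_iff)
    then show ?thesis
      by (cases "fst x"; cases "snd x") (auto simp: g_def edge_diff_def abs_minus_commute)
  qed
  have p_change: "(\<integral>x. (of_bool (fst x \<noteq> snd x) :: real) \<partial>K e) = measure M {w \<in> space M. Y e w \<noteq> Z e w}"
  proof -
    have "(\<integral>x. (of_bool (fst x \<noteq> snd x) :: real) \<partial>K e) = (\<integral>w. of_bool (Y e w \<noteq> Z e w) \<partial>M)"
      unfolding K_def using pair_measurable[OF e(1)] by (subst integral_distr) auto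
    also have "\<dots> = (\<integral>w. (indicator {w \<in> space M. Y e w \<noteq> Z e w} w :: real) \<partial>M)"
      by (intro Bochner_Integration.integral_cong) (auto simp: indicator_def)
    also have "\<dots> = measure M ({w \<in> space M. Y e w \<noteq> Z e w} \<inter> space M)"
      by (rule Bochner_Integration.integral_indicator)
    finally show ?thesis by (simp add: Int_absorb2 subset_iff)
  qed
  have "(\<integral>w. \<bar>\<phi> (hybrid F w) - \<phi> (hybrid (insert e F) w)\<bar> \<partial>M) = (\<integral>w. g (W w) \<partial>M)"
    by (simp add: g_def hW)
  also have "\<dots> = (\<integral>U. g U \<partial>PiM E K)"
    using integral_distr[OF W_meas g_meas] by (simp add: W_law)
  also have "\<dots> = (\<integral>U. (\<integral>x. g (U(e := x)) \<partial>K e) \<partial>PiM E K)"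
    using observableD(5)[OF \<phi>]
    by (intro integral_PiM_resample[where B=1] K e g_meas) (auto simp: g_def)
  also have "\<dots> = (\<integral>U. measure M {w \<in> space M. Y e w \<noteq> Z e w} * edge_diff e \<phi> (h F U) \<partial>PiM E K)"
    unfolding g_upd integral_mult_left_zero p_change ..
  also have "\<dots> = measure M {w \<in> space M. Y e w \<noteq> Z e w} * (\<integral>U. edge_diff e \<phi> (h F U) \<partial>PiM E K)"
    by simp
  also have "(\<integral>U. edge_diff e \<phi> (h F U) \<partial>PiM E K) = (\<integral>w. edge_diff e \<phi> (h F (W w)) \<partial>M)"
    using integral_distr[OF W_meas d_meas] by (simp add: W_law)
  also have "\<dots> = obs_influence \<phi> e"
    unfolding hW obs_influence_def by (rule integral_hybrid[OF measurable_edge_diff[OF \<phi> e(1)]])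
  finally show ?thesis
    using change[OF e(1)] obs_influence_nonneg[of \<phi> e] by (simp add: mult_right_mono)
qed

lemma hybrid_finite:
  assumes \<phi>: "observable \<phi>" and F: "finite F" "F \<subseteq> E"
  shows "(\<integral>w. \<bar>\<phi> (hybrid {} w) - \<phi> (hybrid F w)\<bar> \<partial>M) \<le> q * (\<Sum>e\<in>F. obs_influence \<phi> e)"
  using F
proof (induction F rule: finite_induct)
  case empty
  show ?case by simp
next
  case (insert e F)
  note int[simp] = integrable_hybrid[OF \<phi>]
  have "(\<integral>w. \<bar>\<phi> (hybrid {} w) - \<phi> (hybrid (insert e F) w)\<bar> \<partial>M)
      \<le> (\<integral>w. \<bar>\<phi> (hybrid {} w) - \<phi> (hybrid F w)\<bar> + \<bar>\<phi> (hybrid F w) - \<phi> (hybrid (insert e F) w)\<bar> \<partial>M)"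
    by (intro integral_mono) auto
  also have "\<dots> = (\<integral>w. \<bar>\<phi> (hybrid {} w) - \<phi> (hybrid F w)\<bar> \<partial>M)
      + (\<integral>w. \<bar>\<phi> (hybrid F w) - \<phi> (hybrid (insert e F) w)\<bar> \<partial>M)"
    by simp
  also have "\<dots> \<le> q * (\<Sum>e\<in>F. obs_influence \<phi> e) + q * obs_influence \<phi> e"
    using insert hybrid_step[OF \<phi>, of e F] by (intro add_mono) auto
  finally show ?case using insert by (simp add: algebra_simps)
qed

text \<open>\<open>E\<close> may be infinite, so edges are exchanged one at a time only on the
  finite set \<open>F\<close> of an approximant \<psi>. Passing from \<open>hybrid F\<close> to
  \<open>hybrid E\<close> leaves \<psi> unchanged and costs only two approximation errors, below
  \<epsilon> together.\<close>

theorem integral_dist_le: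
  assumes \<phi>: "observable \<phi>" "locally_approximable \<phi>" and sum: "obs_influence \<phi> summable_on E"
  shows "(\<integral>w. \<bar>\<phi> (\<lambda>e\<in>E. Y e w) - \<phi> (\<lambda>e\<in>E. Z e w)\<bar> \<partial>M) \<le> q * infsum (obs_influence \<phi>) E"
proof (rule field_le_epsilon)
  fix \<epsilon> :: real assume "0 < \<epsilon>"
  obtain F \<psi> where F: "finite F" "F \<subseteq> E" "observable \<psi>" "depends_on F \<psi>"
    "(\<integral>\<eta>. \<bar>\<phi> \<eta> - \<psi> \<eta>\<bar> \<partial>\<mu>) < \<epsilon> / 2"
    using \<phi>(2)[unfolded locally_approximable_def, rule_format, OF half_gt_zero[OF \<open>0 < \<epsilon>\<close>]]
    by (elim exE conjE)
  have YZ: "(\<lambda>e\<in>E. Y e w) = hybrid {} w" "(\<lambda>e\<in>E. Z e w) = hybrid E w" for w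
    by (auto simp: hybrid_def)
  have sp: "hybrid F w \<in> space \<mu>" for F w
    by (auto simp: space_static hybrid_def)
  have \<psi>: "\<psi> (hybrid F w) = \<psi> (hybrid E w)" for w
  proof -
    have "\<forall>e\<in>F. hybrid F w e = hybrid E w e" using F(2) by (auto simp: hybrid_def)
    then show ?thesis using F(4) sp unfolding depends_on_def by blast
  qed
  note int[simp] = integrable_hybrid[OF \<phi>(1)] integrable_hybrid[OF F(3)]
  have d: "(\<integral>w. \<bar>\<phi> (hybrid G w) - \<psi> (hybrid G w)\<bar> \<partial>M) < \<epsilon> / 2" for G
    using integral_hybrid[of "\<lambda>\<eta>. \<bar>\<phi> \<eta> - \<psi> \<eta>\<bar>" G] F(5) observableD(1)[OF \<phi>(1)] observableD(1)[OF F(3)]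
    by simp
  have "(\<integral>w. \<bar>\<phi> (hybrid {} w) - \<phi> (hybrid E w)\<bar> \<partial>M)
      \<le> (\<integral>w. \<bar>\<phi> (hybrid {} w) - \<phi> (hybrid F w)\<bar> + (\<bar>\<phi> (hybrid F w) - \<psi> (hybrid F w)\<bar>
          + \<bar>\<phi> (hybrid E w) - \<psi> (hybrid E w)\<bar>) \<partial>M)"
  proof (intro integral_mono)
    fix w
    show "\<bar>\<phi> (hybrid {} w) - \<phi> (hybrid E w)\<bar> \<le> \<bar>\<phi> (hybrid {} w) - \<phi> (hybrid F w)\<bar>
        + (\<bar>\<phi> (hybrid F w) - \<psi> (hybrid F w)\<bar> + \<bar>\<phi> (hybrid E w) - \<psi> (hybrid E w)\<bar>)"
      using \<psi>[of w] by linarith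
  qed auto
  also have "\<dots> = (\<integral>w. \<bar>\<phi> (hybrid {} w) - \<phi> (hybrid F w)\<bar> \<partial>M)
      + ((\<integral>w. \<bar>\<phi> (hybrid F w) - \<psi> (hybrid F w)\<bar> \<partial>M) + (\<integral>w. \<bar>\<phi> (hybrid E w) - \<psi> (hybrid E w)\<bar> \<partial>M))"
    by simp
  also have "\<dots> \<le> q * (\<Sum>e\<in>F. obs_influence \<phi> e) + (\<epsilon> / 2 + \<epsilon> / 2)"
    using d less_imp_le by (intro add_mono hybrid_finite[OF \<phi>(1) F(1,2)]) blast+
  also have "(\<Sum>e\<in>F. obs_influence \<phi> e) \<le> infsum (obs_influence \<phi>) E"
    using sum F(1,2) by (intro finite_sum_le_infsum) (auto simp: obs_influence_nonneg)
  finally show "(\<integral>w. \<bar>\<phi> (\<lambda>e\<in>E. Y e w) - \<phi> (\<lambda>e\<in>E. Z e w)\<bar> \<partial>M)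
      \<le> q * infsum (obs_influence \<phi>) E + \<epsilon>"
    using q_nonneg by (simp add: YZ mult_left_mono)
qed

end

section \<open>The stationary two-state chain\<close>

text \<open>Cut \<open>[0, t]\<close> into \<open>n\<close> equal pieces:
  \<open>f t \<le> n * f (t / n)\<close>, and the right side tends to \<open>a * t\<close>.\<close>

lemma subadditive_le_linear:
  fixes f :: "real \<Rightarrow> real"
  assumes sub: "\<And>t u. 0 \<le> t \<Longrightarrow> 0 \<le> u \<Longrightarrow> f (t + u) \<le> f t + f u" and "f 0 = 0"
    and lim: "((\<lambda>h. f h / h) \<longlongrightarrow> a) (at_right 0)" and "0 \<le> t"
  shows "f t \<le> a * t"
proof (cases "t = 0")
  case True
  then show ?thesis using \<open>f 0 = 0\<close> by simp
next
  case False
  then have t: "0 < t" using \<open>0 \<le> t\<close> by simp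
  have mult: "f (of_nat n * u) \<le> of_nat n * f u" if "0 \<le> u" for n u
  proof (induction n)
    case (Suc n)
    have "f (of_nat (Suc n) * u) \<le> f (of_nat n * u) + f u"
      using sub[of "of_nat n * u" u] that by (simp add: algebra_simps)
    with Suc show ?case by (simp add: algebra_simps)
  qed (simp add: \<open>f 0 = 0\<close>)
  let ?u = "\<lambda>n. t / of_nat (Suc n)"
  have "filterlim ?u (at_right 0) sequentially"
    unfolding filterlim_at
  proof
    show "\<forall>\<^sub>F n in sequentially. ?u n \<in> {0<..} \<and> ?u n \<noteq> 0" using t by simp
    show "?u \<longlonglongrightarrow> 0"
      using tendsto_mult[OF tendsto_const[of t] LIMSEQ_inverse_real_of_nat] by (simp add: field_simps)
  qed
  then have "(\<lambda>n. f (?u n) / ?u n * t) \<longlonglongrightarrow> a * t"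
    by (intro tendsto_mult[OF filterlim_compose[OF lim] tendsto_const])
  moreover have "f t \<le> f (?u n) / ?u n * t" for n
  proof -
    have "f t = f (of_nat (Suc n) * ?u n)" by simp
    also have "\<dots> \<le> of_nat (Suc n) * f (?u n)" using t by (intro mult) simp
    also have "\<dots> = f (?u n) / ?u n * t" using t by (simp add: field_simps)
    finally show ?thesis .
  qed
  ultimately show ?thesis by (intro LIMSEQ_le_const) auto
qed

lemma derivative_at_0_quotient:
  assumes "(f has_real_derivative a) (at 0 within {0..})" "f 0 = 0"
  shows "((\<lambda>h. f h / h) \<longlongrightarrow> a) (at_right 0)"
proof -
  have "((\<lambda>h. f h / h) \<longlongrightarrow> a) (at 0 within {0..})"
    using assms by (simp add: has_field_derivative_iff)
  then show ?thesis by (rule tendsto_within_subset) auto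
qed

text \<open>By Chapman-Kolmogorov, being switched after \<open>t + u\<close> requires a switch
  across one of the two pieces. The switching probability is therefore subadditive, and its slope at
  0 is the rate.\<close>

lemma transition_function_rates:
  assumes P: "transition_function a b P" and "0 \<le> t"
  shows "P t False True \<le> a * t" "P t True False \<le> b * t"
proof -
  have nn: "\<And>t s s'. 0 \<le> t \<Longrightarrow> 0 \<le> P t s s'"
    and sum1: "\<And>t s. 0 \<le> t \<Longrightarrow> P t s True + P t s False = 1"
    and P0: "\<And>s s'. P 0 s s' = of_bool (s = s')"
    and CK: "\<And>t u s s''. 0 \<le> t \<Longrightarrow> 0 \<le> u \<Longrightarrow>
        P (t + u) s s'' = P t s True * P u True s'' + P t s False * P u False s''"
    and da: "((\<lambda>h. P h False True) has_real_derivative a) (at 0 within {0..})"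
    and db: "((\<lambda>h. P h True False) has_real_derivative b) (at 0 within {0..})"
    using P by (auto simp: transition_function_def UNIV_bool add.commute)
  have le1: "P t s s' \<le> 1" if "0 \<le> t" for t s s'
    using sum1[OF that, of s] nn[OF that, of s True] nn[OF that, of s False] by (cases s') auto
  have sub: "P (t + u) s (\<not> s) \<le> P t s (\<not> s) + P u s (\<not> s)" if "0 \<le> t" "0 \<le> u" for t u s
  proof -
    have "P (t + u) s (\<not> s) = P t s s * P u s (\<not> s) + P t s (\<not> s) * P u (\<not> s) (\<not> s)"
      using CK[OF that] by (cases s) simp_all
    moreover have "P t s s * P u s (\<not> s) \<le> P u s (\<not> s)"
      using that by (intro mult_left_le_one_le nn le1)
    moreover have "P t s (\<not> s) * P u (\<not> s) (\<not> s) \<le> P t s (\<not> s)"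
      using that by (intro mult_left_le nn le1)
    ultimately show ?thesis by linarith
  qed
  show "P t False True \<le> a * t"
    using sub[of _ _ False] P0 da \<open>0 \<le> t\<close> by (intro subadditive_le_linear derivative_at_0_quotient) auto
  show "P t True False \<le> b * t"
    using sub[of _ _ True] P0 db \<open>0 \<le> t\<close> by (intro subadditive_le_linear derivative_at_0_quotient) auto
qed

text \<open>Detailed balance of the rates is lifted to all times without solving for
  \<open>P\<close>.\<close>

lemma transition_function_balance:
  assumes P: "transition_function a b P" and "0 \<le> t" and pi: "pF * a = pT * b" "pF + pT = 1"
  shows "pF * P t False True = pT * P t True False"
proof -
  have nn: "\<And>t s s'. 0 \<le> t \<Longrightarrow> 0 \<le> P t s s'"
    and sum1: "\<And>t s. 0 \<le> t \<Longrightarrow> P t s True + P t s False = 1"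
    and P0: "\<And>s s'. P 0 s s' = of_bool (s = s')"
    and CK: "\<And>t u s s''. 0 \<le> t \<Longrightarrow> 0 \<le> u \<Longrightarrow>
        P (t + u) s s'' = P t s True * P u True s'' + P t s False * P u False s''"
    and da: "((\<lambda>h. P h False True) has_real_derivative a) (at 0 within {0..})"
    and db: "((\<lambda>h. P h True False) has_real_derivative b) (at 0 within {0..})"
    using P by (auto simp: transition_function_def UNIV_bool add.commute)
  \<comment> \<open>The net flow between the two states. It satisfies
    \<open>d (t + u) = d t * c + d u\<close> with a factor \<open>c\<close> of modulus at most 1, so
    its absolute value is subadditive; balance of the rates makes its slope at 0 vanish.\<close>
  define d where "d t = pF * P t False True - pT * P t True False" for t
  have d_add: "d (t + u) = d t * (1 - P u False True - P u True False) + d u" if "0 \<le> t" "0 \<le> u" for t u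
  proof -
    have eqs: "P t False False = 1 - P t False True" "P t True True = 1 - P t True False"
      "P u False False = 1 - P u False True" "P u True True = 1 - P u True False"
      using sum1[OF that(1), of False] sum1[OF that(1), of True]
        sum1[OF that(2), of False] sum1[OF that(2), of True] by linarith+
    show ?thesis unfolding d_def CK[OF that] eqs by (simp add: algebra_simps)
  qed
  have "\<bar>d t\<bar> \<le> 0 * t"
  proof (rule subadditive_le_linear[OF _ _ _ \<open>0 \<le> t\<close>])
    fix t u :: real assume tu: "0 \<le> t" "0 \<le> u"
    have "\<bar>1 - P u False True - P u True False\<bar> \<le> 1"
      using nn[OF tu(2), of False True] nn[OF tu(2), of True False] nn[OF tu(2), of False False]
        nn[OF tu(2), of True True] sum1[OF tu(2), of False] sum1[OF tu(2), of True] by linarith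
    then have "\<bar>d t * (1 - P u False True - P u True False)\<bar> \<le> \<bar>d t\<bar>"
      by (simp add: abs_mult mult_left_le)
    then show "\<bar>d (t + u)\<bar> \<le> \<bar>d t\<bar> + \<bar>d u\<bar>" unfolding d_add[OF tu] by linarith
  next
    show "\<bar>d 0\<bar> = 0" by (simp add: d_def P0)
    have "(d has_real_derivative (pF * a - pT * b)) (at 0 within {0..})"
      unfolding d_def[abs_def] by (intro derivative_intros da db DERIV_cmult)
    then have "((\<lambda>h. d h / h) \<longlongrightarrow> 0) (at_right 0)"
      using derivative_at_0_quotient[of d] pi by (simp add: d_def P0)
    then have "((\<lambda>h. \<bar>d h / h\<bar>) \<longlongrightarrow> 0) (at_right 0)" by (rule tendsto_rabs_zero)
    then show "((\<lambda>h. \<bar>d h\<bar> / h) \<longlongrightarrow> 0) (at_right 0)"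
      by (rule tendsto_cong[THEN iffD1, rotated])
        (auto simp: eventually_at_right_less abs_divide intro: eventually_mono[OF eventually_at_right_less])
  qed
  then show ?thesis by (simp add: d_def)
qed

section \<open>One edge under its stationary law\<close>

locale stationary_chain = prob_space M for M :: "'w measure" +
  fixes p :: real and Y :: "real \<Rightarrow> 'w \<Rightarrow> bool"
  assumes p01: "0 \<le> p" "p \<le> 1"
    and chain: "two_state_chain M (bernoulli_pmf p) p (1 - p) Y"
begin

lemma chain_measurable: "0 \<le> t \<Longrightarrow> Y t \<in> measurable M (count_space UNIV)"
  using chain by (auto simp: two_state_chain_def)

lemma prob_split:
  assumes "{w \<in> space M. A w} \<in> events" "{w \<in> space M. B w} \<in> events"
  shows "prob {w \<in> space M. A w} = prob {w \<in> space M. B w \<and> A w} + prob {w \<in> space M. \<not> B w \<and> A w}"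
proof -
  have "prob ({w \<in> space M. A w} \<inter> {w \<in> space M. B w} \<union> ({w \<in> space M. A w} - {w \<in> space M. B w}))
      = prob ({w \<in> space M. A w} \<inter> {w \<in> space M. B w}) + prob ({w \<in> space M. A w} - {w \<in> space M. B w})"
    using assms by (intro finite_measure_Union) auto
  also have "{w \<in> space M. A w} \<inter> {w \<in> space M. B w} \<union> ({w \<in> space M. A w} - {w \<in> space M. B w}) = {w \<in> space M. A w}"
    by auto
  also have "{w \<in> space M. A w} \<inter> {w \<in> space M. B w} = {w \<in> space M. B w \<and> A w}" by auto
  also have "{w \<in> space M. A w} - {w \<in> space M. B w} = {w \<in> space M. \<not> B w \<and> A w}" by auto
  finally show ?thesis .
qed

text \<open>The finite-dimensional formula always starts at time 0, so the joint law at two later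
  times is reached through the triple of times \<open>0\<close>, \<open>s\<close>,
  \<open>t\<close>.\<close>

lemma chain_transition:
  obtains P where "transition_function p (1 - p) P"
    and "\<And>s a b. 0 \<le> s \<Longrightarrow> prob {w \<in> space M. Y 0 w = a \<and> Y s w = b} = pmf (bernoulli_pmf p) a * P s a b"
    and "\<And>s t a b c. 0 \<le> s \<Longrightarrow> s \<le> t \<Longrightarrow> prob {w \<in> space M. Y 0 w = a \<and> Y s w = b \<and> Y t w = c}
      = pmf (bernoulli_pmf p) a * P s a b * P (t - s) b c"
proof -
  obtain P where P: "transition_function p (1 - p) P"
    and fdd: "\<And>n (t :: nat \<Rightarrow> real) (s :: nat \<Rightarrow> bool).
           t 0 = 0 \<and> (\<forall>i<n. t i \<le> t (Suc i)) \<Longrightarrow>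
           prob {\<omega> \<in> space M. \<forall>i\<le>n. Y (t i) \<omega> = s i} =
             pmf (bernoulli_pmf p) (s 0) * (\<Prod>i<n. P (t (Suc i) - t i) (s i) (s (Suc i)))"
    using chain unfolding two_state_chain_def by blast
  show ?thesis
  proof (rule that[OF P])
    fix s a b assume "(0::real) \<le> s"
    then show "prob {w \<in> space M. Y 0 w = a \<and> Y s w = b} = pmf (bernoulli_pmf p) a * P s a b"
      using fdd[of "\<lambda>i. if i = 0 then 0 else s" 1 "\<lambda>i. if i = 0 then a else b"]
      by (simp add: le_Suc_eq all_conj_distrib conj_commute)
  next
    fix s t a b c assume "(0::real) \<le> s" "s \<le> t"
    then show "prob {w \<in> space M. Y 0 w = a \<and> Y s w = b \<and> Y t w = c}
      = pmf (bernoulli_pmf p) a * P s a b * P (t - s) b c"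
      using fdd[of "\<lambda>i. if i = 0 then 0 else if i = 1 then s else t" 2
          "\<lambda>i. if i = 0 then a else if i = 1 then b else c"]
      by (simp add: numeral_2_eq_2 le_Suc_eq all_conj_distrib less_Suc_eq conj_commute conj_left_commute)
  qed
qed

text \<open>Stationarity follows from detailed balance, as the rates satisfy
  \<open>(1 - p) * p = p * (1 - p)\<close>.\<close>

lemma chain_law:
  assumes "0 \<le> s"
  shows "distr M (count_space UNIV) (Y s) = measure_pmf (bernoulli_pmf p)"
proof -
  note [measurable] = chain_measurable[OF assms] chain_measurable[OF order_refl]
  obtain P where P: "transition_function p (1 - p) P"
    and two: "\<And>s a b. 0 \<le> s \<Longrightarrow> prob {w \<in> space M. Y 0 w = a \<and> Y s w = b} = pmf (bernoulli_pmf p) a * P s a b"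
    by (rule chain_transition) (rule that)
  have bal: "(1 - p) * P s False True = p * P s True False"
    by (rule transition_function_balance[OF P assms]) auto
  have one: "P s b True + P s b False = 1" for b
    using P assms by (auto simp: transition_function_def UNIV_bool add.commute)
  have prob_eq: "prob {w \<in> space M. Y s w = c} = pmf (bernoulli_pmf p) c" for c
  proof -
    have "prob {w \<in> space M. Y s w = c} 
        = prob {w \<in> space M. Y 0 w = True \<and> Y s w = c} + prob {w \<in> space M. Y 0 w = False \<and> Y s w = c}"
      using prob_split[of "\<lambda>w. Y s w = c" "\<lambda>w. Y 0 w"] by simp
    also have "\<dots> = p * P s True c + (1 - p) * P s False c"
      using two[OF assms, of True c] two[OF assms, of False c] p01 by (simp del: not_True_eq_False)
    also have "\<dots> = pmf (bernoulli_pmf p) c"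
    proof (cases c)
      case True
      have "p * P s True True + (1 - p) * P s False True = p" using bal one[of True] by algebra
      then show ?thesis using True p01 by simp
    next
      case False
      have "p * P s True False + (1 - p) * P s False False = 1 - p" using bal one[of False] by algebra
      then show ?thesis using False p01 by simp
    qed
    finally show ?thesis .
  qed
  show ?thesis
  proof (rule measure_eqI_countable[where A=UNIV])
    fix c :: bool
    have "Y s -` {c} \<inter> space M = {w \<in> space M. Y s w = c}" by auto
    then have "emeasure (distr M (count_space UNIV) (Y s)) {c} = ennreal (prob {w \<in> space M. Y s w = c})"
      using chain_measurable[OF assms] by (simp only: emeasure_distr emeasure_eq_measure sets_count_space Pow_UNIV UNIV_I)
    then show "emeasure (distr M (count_space UNIV) (Y s)) {c} = emeasure (measure_pmf (bernoulli_pmf p)) {c}"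
      by (simp only: prob_eq emeasure_pmf_single)
  qed auto
qed

text \<open>By stationarity and the rate bounds, the probability is at most
  \<open>2 * p * (1 - p) * (t - s)\<close>; the factor is then bounded by 1 to obtain an estimate
  uniform over the edges.\<close>

lemma chain_change:
  assumes "0 \<le> s" "s \<le> t"
  shows "prob {w \<in> space M. Y s w \<noteq> Y t w} \<le> t - s"
proof -
  have "0 \<le> t" using assms by simp
  note [measurable] = chain_measurable[OF assms(1)] chain_measurable[OF order_refl] chain_measurable[OF \<open>0 \<le> t\<close>]
  obtain P where P: "transition_function p (1 - p) P"
    and three: "\<And>s t a b c. 0 \<le> s \<Longrightarrow> s \<le> t \<Longrightarrow> prob {w \<in> space M. Y 0 w = a \<and> Y s w = b \<and> Y t w = c}
      = pmf (bernoulli_pmf p) a * P s a b * P (t - s) b c"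
    by (rule chain_transition) (rule that)
  have bal: "(1 - p) * P s False True = p * P s True False"
    by (rule transition_function_balance[OF P assms(1)]) auto
  have one: "P s b True + P s b False = 1" for b
    using P assms by (auto simp: transition_function_def UNIV_bool add.commute)
  have two: "prob {w \<in> space M. Y s w = b \<and> Y t w = c} = (p * P s True b + (1 - p) * P s False b) * P (t - s) b c" for b c
    using prob_split[of "\<lambda>w. Y s w = b \<and> Y t w = c" "\<lambda>w. Y 0 w"]
      three[OF assms, of True b c] three[OF assms, of False b c] p01
    by (simp add: algebra_simps)
  have "prob {w \<in> space M. Y s w \<noteq> Y t w} 
      = prob {w \<in> space M. Y s w = True \<and> Y t w = False} + prob {w \<in> space M. Y s w = False \<and> Y t w = True}"
  proof -
    have "{w \<in> space M. Y s w \<and> Y s w \<noteq> Y t w} = {w \<in> space M. Y s w = True \<and> Y t w = False}"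
      "{w \<in> space M. \<not> Y s w \<and> Y s w \<noteq> Y t w} = {w \<in> space M. Y s w = False \<and> Y t w = True}" by auto
    then show ?thesis using prob_split[of "\<lambda>w. Y s w \<noteq> Y t w" "\<lambda>w. Y s w"] by simp
  qed
  also have "\<dots> = p * P (t - s) True False + (1 - p) * P (t - s) False True"
  proof -
    have "p * P s True True + (1 - p) * P s False True = p"
      "p * P s True False + (1 - p) * P s False False = 1 - p"
      using bal one[of True] one[of False] by algebra+
    then show ?thesis unfolding two by simp
  qed
  also have "\<dots> \<le> p * ((1 - p) * (t - s)) + (1 - p) * (p * (t - s))"
    using transition_function_rates[OF P, of "t - s"] assms p01 by (intro add_mono mult_left_mono) auto
  also have "\<dots> = (2 * p * (1 - p)) * (t - s)" by (simp add: algebra_simps)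
  also have "\<dots> \<le> 1 * (t - s)"
  proof (rule mult_right_mono)
    \<comment> \<open>Expanding the squares gives \<open>1 - 2 * p * (1 - p)\<close>.\<close>
    have "0 \<le> (1 - p)\<^sup>2 + p\<^sup>2" by simp
    then show "2 * p * (1 - p) \<le> 1" by (simp add: power2_eq_square algebra_simps)
  qed (use assms in simp)
  finally show ?thesis by simp
qed

end

section \<open>Clusters and edge boundaries\<close>

definition edge_boundary :: "'v set set \<Rightarrow> 'v set \<Rightarrow> 'v set set" where
  "edge_boundary E C = {e \<in> E. e \<inter> C \<noteq> {} \<and> \<not> e \<subseteq> C}"

definition finite_sets_around :: "'v set \<Rightarrow> 'v \<Rightarrow> 'v set set" where
  "finite_sets_around V x = {C. finite C \<and> C \<subseteq> V \<and> x \<in> C}"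

lemma open_cluster_refl: "x \<in> open_cluster E \<eta> x"
  by (simp add: open_cluster_def)

lemma open_cluster_step:
  "y \<in> open_cluster E \<eta> x \<Longrightarrow> {y, z} \<in> E \<Longrightarrow> \<eta> {y, z} \<Longrightarrow> z \<in> open_cluster E \<eta> x"
  unfolding open_cluster_def by (auto intro: rtrancl_into_rtrancl)

lemma open_cluster_subset:
  assumes "x \<in> C" and "\<And>y z. y \<in> C \<Longrightarrow> {y, z} \<in> E \<Longrightarrow> \<eta> {y, z} \<Longrightarrow> z \<in> C"
  shows "open_cluster E \<eta> x \<subseteq> C"
proof
  fix y assume "y \<in> open_cluster E \<eta> x"
  then have "(x, y) \<in> {(a, b). {a, b} \<in> E \<and> \<eta> {a, b}}\<^sup>*" by (simp add: open_cluster_def)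
  then show "y \<in> C" by (induction rule: rtrancl_induct) (use assms in auto)
qed

lemma open_cluster_mono:
  assumes "\<And>e. e \<in> E \<Longrightarrow> \<eta> e \<Longrightarrow> \<eta>' e"
  shows "open_cluster E \<eta> x \<subseteq> open_cluster E \<eta>' x"
  by (intro open_cluster_subset open_cluster_refl) (use assms in \<open>auto intro: open_cluster_step\<close>)

lemma percolates_mono:
  assumes "percolates E \<eta> x" "\<And>e. e \<in> E \<Longrightarrow> \<eta> e \<Longrightarrow> \<eta>' e"
  shows "percolates E \<eta>' x"
  using assms(1) open_cluster_mono[of E \<eta> \<eta>' x] assms(2)
  unfolding percolates_def by (meson finite_subset)

lemma percolates_restrict: "percolates E (\<lambda>e\<in>E. \<eta> e) x = percolates E \<eta> x"
  by (auto elim!: percolates_mono)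

lemma percolates_neighbour:
  assumes "percolates E \<eta> b" "{a, b} \<in> E" "\<eta> {a, b}"
  shows "percolates E \<eta> a"
proof -
  have "b \<in> open_cluster E \<eta> a" using assms by (auto intro: open_cluster_step open_cluster_refl)
  then have "open_cluster E \<eta> b \<subseteq> open_cluster E \<eta> a"
    by (intro open_cluster_subset) (auto intro: open_cluster_step)
  then show ?thesis using assms(1) unfolding percolates_def by (meson finite_subset)
qed

text \<open>An infinite cluster must leave every finite set through an open boundary edge; a finite
  cluster is itself a finite set without such an edge. In a countable, locally finite graph this
  describes percolation by countably many conditions on finitely many edges each, which yields
  measurability, approximation and stability near a time.\<close>

lemma percolates_iff_boundary:
  assumes G: "simple_graph V E" and x: "x \<in> V"
  shows "percolates E \<eta> x \<longleftrightarrow> (\<forall>C\<in>finite_sets_around V x. \<exists>e\<in>edge_boundary E C. \<eta> e)"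
proof
  assume perc: "percolates E \<eta> x"
  show "\<forall>C\<in>finite_sets_around V x. \<exists>e\<in>edge_boundary E C. \<eta> e"
  proof (rule ccontr)
    assume "\<not> ?thesis"
    then obtain C where C: "finite C" "x \<in> C" "\<And>e. e \<in> edge_boundary E C \<Longrightarrow> \<not> \<eta> e"
      by (auto simp: finite_sets_around_def)
    have "open_cluster E \<eta> x \<subseteq> C"
    proof (rule open_cluster_subset[OF C(2)], rule ccontr)
      fix y z assume "y \<in> C" "{y, z} \<in> E" "\<eta> {y, z}" "z \<notin> C"
      then show False using C(3)[of "{y, z}"] by (auto simp: edge_boundary_def)
    qed
    then show False using perc C(1) by (auto simp: percolates_def dest: finite_subset)
  qed
next
  assume cuts: "\<forall>C\<in>finite_sets_around V x. \<exists>e\<in>edge_boundary E C. \<eta> e"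
  show "percolates E \<eta> x"
  proof (rule ccontr)
    let ?C = "open_cluster E \<eta> x"
    assume "\<not> percolates E \<eta> x"
    moreover have "?C \<subseteq> V"
      by (rule open_cluster_subset[OF x]) (use G in \<open>auto simp: simple_graph_def\<close>)
    ultimately have "?C \<in> finite_sets_around V x"
      by (auto simp: finite_sets_around_def percolates_def open_cluster_refl)
    then obtain e where e: "e \<in> E" "e \<inter> ?C \<noteq> {}" "\<not> e \<subseteq> ?C" "\<eta> e"
      using cuts unfolding edge_boundary_def by blast
    then obtain a b where ab: "a \<in> e" "a \<in> ?C" "b \<in> e" "b \<notin> ?C" by auto
    have "card e = 2" using G e(1) by (auto simp: simple_graph_def)
    then have "e = {a, b}" using ab by (auto simp: card_2_iff)
    then show False using open_cluster_step[OF ab(2)] e ab(4) by auto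
  qed
qed

text \<open>Opening \<open>F\<close> can only join the clusters of \<open>x\<close> and of the
  endpoints of \<open>F\<close>: finitely many clusters, each of them finite.\<close>

lemma not_percolates_finite_opening:
  assumes G: "simple_graph V E" and F: "finite F" "F \<subseteq> E"
    and np: "\<And>v. v \<in> V \<Longrightarrow> \<not> percolates E \<eta> v" and x: "x \<in> V"
  shows "\<not> percolates E (\<lambda>e. \<eta> e \<or> e \<in> F) x"
proof -
  let ?C = "\<Union>v\<in>insert x (\<Union>F). open_cluster E \<eta> v"
  have E: "finite e" "e \<subseteq> V" if "e \<in> E" for e
  proof -
    have "card e = 2" "e \<subseteq> V" using G that by (auto simp: simple_graph_def)
    then show "finite e" "e \<subseteq> V" by (auto intro: card_ge_0_finite)
  qed
  have "finite (\<Union>F)" using F E(1) by (intro finite_Union) auto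
  have "\<Union>F \<subseteq> V" using F(2) E(2) by blast
  have "finite ?C"
  proof (rule finite_UN_I)
    show "finite (insert x (\<Union>F))" using \<open>finite (\<Union>F)\<close> by simp
    show "finite (open_cluster E \<eta> v)" if "v \<in> insert x (\<Union>F)" for v
      using that x \<open>\<Union>F \<subseteq> V\<close> np unfolding percolates_def by blast
  qed
  moreover have "open_cluster E (\<lambda>e. \<eta> e \<or> e \<in> F) x \<subseteq> ?C"
  proof (rule open_cluster_subset)
    show "x \<in> ?C" using open_cluster_refl[of x E \<eta>] by blast
    fix y z assume y: "y \<in> ?C" and e: "{y, z} \<in> E" "\<eta> {y, z} \<or> {y, z} \<in> F"
    show "z \<in> ?C"
    proof (cases "\<eta> {y, z}")
      case True
      obtain v where v: "v \<in> insert x (\<Union>F)" "y \<in> open_cluster E \<eta> v" using y by blast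
      have "z \<in> open_cluster E \<eta> v" by (rule open_cluster_step[OF v(2) e(1)]) (rule True)
      with v(1) show ?thesis by blast
    next
      case False
      then have "z \<in> \<Union>F" using e(2) by auto
      then show ?thesis using open_cluster_refl[of z E \<eta>] by blast
    qed
  qed
  ultimately show ?thesis by (auto simp: percolates_def dest: finite_subset)
qed

section \<open>Infinite connected locally finite graphs\<close>

locale percolation_graph =
  fixes V :: "'v set" and E :: "'v set set" and p :: "'v set \<Rightarrow> real"
  assumes simple: "simple_graph V E" and infinite_V: "infinite V"
    and connected: "connected_graph V E" and locally_finite: "locally_finite_graph V E"
    and p_pos: "\<And>e. e \<in> E \<Longrightarrow> 0 < p e" and p_le_1: "\<And>e. e \<in> E \<Longrightarrow> p e \<le> 1"
begin

sublocale edge_percolation E p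
  by unfold_locales (auto simp: p_le_1 less_imp_le p_pos)

lemma finite_edge_boundary:
  assumes "C \<in> finite_sets_around V x" shows "finite (edge_boundary E C)"
proof (rule finite_subset)
  show "edge_boundary E C \<subseteq> (\<Union>v\<in>C. {e \<in> E. v \<in> e})" by (auto simp: edge_boundary_def)
  show "finite (\<Union>v\<in>C. {e \<in> E. v \<in> e})"
    using assms locally_finite by (auto simp: finite_sets_around_def locally_finite_graph_def)
qed

lemma edge_boundary_subset: "edge_boundary E C \<subseteq> E"
  by (auto simp: edge_boundary_def)

lemma V_nonempty: "V \<noteq> {}"
  using infinite_V by auto

text \<open>By connectedness \<open>V\<close> is covered by the sets of vertices reached from one
  vertex in \<open>n\<close> steps, and local finiteness keeps each of them countable.\<close>

lemma countable_V: "countable V"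
proof -
  let ?R = "{(a, b). {a, b} \<in> E}"
  obtain x where x: "x \<in> V" using V_nonempty by auto
  have fin: "finite (?R `` {y})" for y
  proof (cases "y \<in> V")
    case True
    have "finite ((\<lambda>z. {y, z}) ` (?R `` {y}))"
      by (rule finite_subset[of _ "{e \<in> E. y \<in> e}"])
        (use True locally_finite in \<open>auto simp: locally_finite_graph_def\<close>)
    then show ?thesis by (rule finite_imageD) (auto simp: inj_on_def doubleton_eq_iff)
  next
    case False
    then have "?R `` {y} = {}" using simple by (auto simp: simple_graph_def)
    then show ?thesis by simp
  qed
  have "countable ((?R ^^ n) `` {x})" for n
  proof (induction n)
    case (Suc n)
    have "(?R ^^ Suc n) `` {x} = (\<Union>y\<in>(?R ^^ n) `` {x}. ?R `` {y})" by auto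
    then show ?case using countable_UN[OF Suc countable_finite[OF fin]] by (simp only:)
  qed simp
  then have "countable (\<Union>n. (?R ^^ n) `` {x})" by simp
  moreover have "V \<subseteq> (\<Union>n. (?R ^^ n) `` {x})"
  proof
    fix v assume "v \<in> V"
    then have "(x, v) \<in> ?R\<^sup>*" using connected x by (simp add: connected_graph_def)
    then show "v \<in> (\<Union>n. (?R ^^ n) `` {x})" by (auto simp: rtrancl_power)
  qed
  ultimately show ?thesis by (rule countable_subset[rotated])
qed

lemma countable_E: "countable E"
proof (rule countable_subset)
  show "E \<subseteq> (\<Union>v\<in>V. {e \<in> E. v \<in> e})"
  proof
    fix e assume "e \<in> E"
    then have "card e = 2" "e \<subseteq> V" using simple by (auto simp: simple_graph_def)
    then obtain v where "v \<in> e" by (metis card.empty ex_in_conv zero_neq_numeral)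
    then show "e \<in> (\<Union>v\<in>V. {e \<in> E. v \<in> e})" using \<open>e \<in> E\<close> \<open>e \<subseteq> V\<close> by auto
  qed
  show "countable (\<Union>v\<in>V. {e \<in> E. v \<in> e})"
    using countable_V locally_finite by (auto simp: locally_finite_graph_def intro: countable_finite)
qed

text \<open>The product form of independence behind the joint laws is applied with a nonempty index
  set.\<close>

lemma E_nonempty: "E \<noteq> {}"
proof
  assume E: "E = {}"
  obtain x where x: "x \<in> V" using V_nonempty by auto
  have "infinite (V - {x})" using infinite_V by simp
  then obtain y where y: "y \<in> V" "y \<noteq> x" by (metis Diff_iff finite.emptyI insertI1 ex_in_conv)
  then show False using connected x E by (auto simp: connected_graph_def)
qed

lemma countable_finite_sets_around: "countable (finite_sets_around V x)"
  by (rule countable_subset[OF _ countable_Collect_finite_subset[OF countable_V]])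
    (auto simp: finite_sets_around_def)

section \<open>Percolation from a vertex as an observable\<close>

definition perc :: "'v \<Rightarrow> ('v set \<Rightarrow> bool) \<Rightarrow> real" where
  "perc x \<eta> = of_bool (percolates E \<eta> x)"

lemma perc_restrict: "perc x (\<lambda>e\<in>E. \<eta> e) = perc x \<eta>"
  by (simp add: perc_def percolates_restrict)

lemma sets_edge_open: "e \<in> E \<Longrightarrow> {\<eta> \<in> space \<mu>. \<eta> e} \<in> sets \<mu>"
  unfolding static_percolation_def by measurable

lemma sets_crossing:
  assumes "C \<in> finite_sets_around V x"
  shows "{\<eta> \<in> space \<mu>. \<exists>e\<in>edge_boundary E C. \<eta> e} \<in> sets \<mu>"
  by (intro sets.sets_Collect_countable_Ex'[where P="\<lambda>e \<eta>. \<eta> e"] sets_edge_open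
      countable_finite[OF finite_edge_boundary[OF assms]] subsetD[OF edge_boundary_subset])

lemma observable_perc:
  assumes "x \<in> V" shows "observable (perc x)"
proof -
  have "{\<eta> \<in> space \<mu>. percolates E \<eta> x} \<in> sets \<mu>"
    unfolding percolates_iff_boundary[OF simple assms]
    by (intro sets.sets_Collect_countable_All' sets_crossing countable_finite_sets_around)
  then have "perc x \<in> borel_measurable \<mu>" unfolding perc_def[abs_def] by measurable
  then show ?thesis by (auto simp: observable_def perc_def)
qed

text \<open>Enumerate the finite sets around \<open>x\<close> and require an open boundary edge only
  for the first \<open>m + 1\<close> of them. These events depend on finitely many edges and
  decrease to percolation, so dominated convergence applies.\<close>

lemma locally_approximable_perc:
  assumes x: "x \<in> V" shows "locally_approximable (perc x)"
  unfolding locally_approximable_def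
proof (intro allI impI)
  fix \<epsilon> :: real assume "0 < \<epsilon>"
  define c where "c = from_nat_into (finite_sets_around V x)"
  have ne: "finite_sets_around V x \<noteq> {}" using x by (auto simp: finite_sets_around_def intro: exI[of _ "{x}"])
  have range_c: "range c = finite_sets_around V x"
    unfolding c_def by (rule range_from_nat_into[OF ne countable_finite_sets_around])
  then have c: "c k \<in> finite_sets_around V x" for k by auto
  define A where "A m \<eta> \<longleftrightarrow> (\<forall>k\<in>{..m}. \<exists>e\<in>edge_boundary E (c k). \<eta> e)"
    for m :: nat and \<eta> :: "'v set \<Rightarrow> bool"
  define \<psi> where "\<psi> m \<eta> = (of_bool (A m \<eta>) :: real)" for m \<eta>
  define F where "F m = (\<Union>k\<le>m. edge_boundary E (c k))" for m
  have perc_A: "percolates E \<eta> x \<longleftrightarrow> (\<forall>m. A m \<eta>)" for \<eta>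
    unfolding percolates_iff_boundary[OF simple x] range_c[symmetric] A_def by auto
  have "{\<eta> \<in> space \<mu>. A m \<eta>} \<in> sets \<mu>" for m
    unfolding A_def by (intro sets.sets_Collect_countable_All' sets_crossing[OF c] countable_finite finite_atMost)
  then have \<psi>_meas: "\<psi> m \<in> borel_measurable \<mu>" for m unfolding \<psi>_def[abs_def] by measurable
  have obs: "observable (\<psi> m)" for m
    using \<psi>_meas by (auto simp: observable_def \<psi>_def)
  have dep: "depends_on (F m) (\<psi> m)" for m
    unfolding depends_on_def
  proof (intro ballI impI)
    fix \<eta> \<eta>' :: "'v set \<Rightarrow> bool" assume "\<forall>e\<in>F m. \<eta> e = \<eta>' e"
    then have "A m \<eta> = A m \<eta>'" unfolding A_def F_def by blast
    then show "\<psi> m \<eta> = \<psi> m \<eta>'" by (simp only: \<psi>_def)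
  qed
  have fin: "finite (F m)" "F m \<subseteq> E" for m
    using finite_edge_boundary[OF c] edge_boundary_subset by (auto simp: F_def)
  \<comment> \<open>For each \<eta> the difference is eventually 0: without percolation some finite
    set fails, and all later \<open>A m\<close> fail with it.\<close>
  have lim: "(\<lambda>m. \<bar>perc x \<eta> - \<psi> m \<eta>\<bar>) \<longlonglongrightarrow> 0" for \<eta>
  proof (rule tendsto_eventually)
    show "\<forall>\<^sub>F m in sequentially. \<bar>perc x \<eta> - \<psi> m \<eta>\<bar> = 0"
    proof (cases "percolates E \<eta> x")
      case True
      then have "A m \<eta>" for m using perc_A by auto
      then show ?thesis using True by (simp add: perc_def \<psi>_def)
    next
      case False
      then obtain m0 where "\<not> A m0 \<eta>" using perc_A by auto
      then have "\<not> A m \<eta>" if "m \<ge> m0" for m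
        using that unfolding A_def by (meson atMost_iff order_trans)
      then show ?thesis using False
        by (auto simp: perc_def \<psi>_def eventually_sequentially)
    qed
  qed
  have "(\<lambda>m. (\<integral>\<eta>. \<bar>perc x \<eta> - \<psi> m \<eta>\<bar> \<partial>\<mu>)) \<longlonglongrightarrow> (\<integral>\<eta>. 0 \<partial>\<mu>)"
  proof (rule integral_dominated_convergence[where w="\<lambda>_. 1"])
    show "(\<lambda>\<eta>. \<bar>perc x \<eta> - \<psi> m \<eta>\<bar>) \<in> borel_measurable \<mu>" for m
      using observableD(1)[OF observable_perc[OF x]] \<psi>_meas by measurable
    show "AE \<eta> in \<mu>. (\<lambda>m. \<bar>perc x \<eta> - \<psi> m \<eta>\<bar>) \<longlonglongrightarrow> 0" using lim by simp
    show "AE \<eta> in \<mu>. norm \<bar>perc x \<eta> - \<psi> m \<eta>\<bar> \<le> 1" for m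
      by (auto simp: perc_def \<psi>_def)
  qed auto
  then have "(\<lambda>m. (\<integral>\<eta>. \<bar>perc x \<eta> - \<psi> m \<eta>\<bar> \<partial>\<mu>)) \<longlonglongrightarrow> 0" by simp
  from order_tendstoD(2)[OF this \<open>0 < \<epsilon>\<close>]
  obtain m where "(\<integral>\<eta>. \<bar>perc x \<eta> - \<psi> m \<eta>\<bar> \<partial>\<mu>) < \<epsilon>"
    by (auto simp: eventually_sequentially)
  then show "\<exists>F \<psi>. finite F \<and> F \<subseteq> E \<and> observable \<psi> \<and> depends_on F \<psi> \<and> (\<integral>\<eta>. \<bar>perc x \<eta> - \<psi> \<eta>\<bar> \<partial>\<mu>) < \<epsilon>"
    by (intro exI[of _ "F m"] exI[of _ "\<psi> m"] conjI fin obs dep)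
qed

text \<open>One of the two updates at \<open>e\<close> is \<eta> itself and the other is \<eta>
  flipped, so the difference detects exactly pivotality.\<close>

lemma obs_influence_perc:
  assumes e: "e \<in> E"
  shows "obs_influence (perc x) e = influence E p (percolation_event E p x) e"
proof -
  let ?S = "{\<eta> \<in> space \<mu>. pivotal (percolation_event E p x) e \<eta>}"
  have "edge_diff e (perc x) \<eta> = indicator ?S \<eta>" if "\<eta> \<in> space \<mu>" for \<eta>
  proof (cases "\<eta> e")
    case True
    then have "\<eta>(e := True) = \<eta>" by (auto simp: fun_eq_iff)
    then show ?thesis using that True update_in_space[OF that e]
      by (auto simp: edge_diff_def perc_def pivotal_def percolation_event_def indicator_def)
  next
    case False
    then have "\<eta>(e := False) = \<eta>" by (auto simp: fun_eq_iff)
    then show ?thesis using that False update_in_space[OF that e]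
      by (auto simp: edge_diff_def perc_def pivotal_def percolation_event_def indicator_def)
  qed
  then have "obs_influence (perc x) e = (\<integral>\<eta>. indicator ?S \<eta> \<partial>\<mu>)"
    unfolding obs_influence_def by (rule Bochner_Integration.integral_cong[OF refl])
  also have "\<dots> = measure \<mu> (?S \<inter> space \<mu>)" by (rule Bochner_Integration.integral_indicator)
  also have "?S \<inter> space \<mu> = ?S" by auto
  finally show ?thesis by (simp add: influence_def)
qed

text \<open>A nonzero average has a nonzero term, so some setting of the edges in \<open>es\<close>
  makes \<open>x\<close> percolate; by monotonicity, opening all of them does too.\<close>

lemma resample_list_perc_nonzero:
  "resample_list es (perc x) \<eta> \<noteq> 0 \<Longrightarrow> percolates E (\<lambda>e. \<eta> e \<or> e \<in> set es) x"
proof (induction es arbitrary: \<eta>)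
  case Nil
  then show ?case by (simp add: perc_def split: if_splits)
next
  case (Cons e es)
  have "\<exists>b. resample_list es (perc x) (\<eta>(e := b)) \<noteq> 0"
  proof (rule ccontr)
    assume "\<not> ?thesis"
    then have "resample_list (e # es) (perc x) \<eta> = 0" by (simp add: resample_def)
    with Cons.prems show False by simp
  qed
  then obtain b where "resample_list es (perc x) (\<eta>(e := b)) \<noteq> 0" ..
  then have "percolates E (\<lambda>e'. (\<eta>(e := b)) e' \<or> e' \<in> set es) x" by (rule Cons.IH)
  then show ?case by (rule percolates_mono) (auto split: if_splits)
qed

text \<open>If \<open>b\<close> percolates, opening the edge to \<open>a\<close> makes
  \<open>a\<close> percolate. Resampling that edge opens it with probability
  \<open>p {a, b} > 0\<close>, independently of the rest.\<close>

lemma perc_prob_neighbour: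
  assumes ab: "a \<in> V" "b \<in> V" "{a, b} \<in> E" and pos: "0 < (\<integral>\<eta>. perc b \<eta> \<partial>\<mu>)"
  shows "0 < (\<integral>\<eta>. perc a \<eta> \<partial>\<mu>)"
proof -
  let ?e = "{a, b}"
  note obs = observable_perc[OF ab(1)]
  have p: "0 < p ?e" "p ?e \<le> 1" using p_pos p_le_1 ab by auto
  have "0 < p ?e * (\<integral>\<eta>. perc b \<eta> \<partial>\<mu>)" using pos p by simp
  also have "\<dots> = (\<integral>\<eta>. p ?e * perc b \<eta> \<partial>\<mu>)" by simp
  also have "\<dots> \<le> (\<integral>\<eta>. resample ?e (perc a) \<eta> \<partial>\<mu>)"
  proof (intro integral_mono)
    show "integrable \<mu> (\<lambda>\<eta>. p ?e * perc b \<eta>)"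
      using integrable_observable[OF observable_perc[OF ab(2)]] by simp
    show "integrable \<mu> (resample ?e (perc a))"
      by (intro integrable_observable observable_resample obs ab)
    fix \<eta>
    have "perc b \<eta> \<le> perc a (\<eta>(?e := True))"
    proof (cases "percolates E \<eta> b")
      case True
      then have "percolates E (\<eta>(?e := True)) b" by (rule percolates_mono) auto
      then have "percolates E (\<eta>(?e := True)) a" by (rule percolates_neighbour) (use ab in auto)
      then show ?thesis by (simp add: perc_def)
    qed (simp add: perc_def)
    then have "p ?e * perc b \<eta> \<le> perc a (\<eta>(?e := True)) * p ?e" using p by simp
    moreover have "0 \<le> perc a (\<eta>(?e := False)) * (1 - p ?e)" using p by (simp add: perc_def)
    ultimately show "p ?e * perc b \<eta> \<le> resample ?e (perc a) \<eta>" unfolding resample_def by linarith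
  qed
  also have "\<dots> = (\<integral>\<eta>. perc a \<eta> \<partial>\<mu>)"
    by (rule integral_resample[symmetric, OF observableD(1)[OF obs] ab(3) observableD(4)[OF obs]])
  finally show ?thesis .
qed

lemma perc_prob_pos:
  assumes "v \<in> V" "x \<in> V" "0 < (\<integral>\<eta>. perc v \<eta> \<partial>\<mu>)"
  shows "0 < (\<integral>\<eta>. perc x \<eta> \<partial>\<mu>)"
proof -
  have "(x, v) \<in> {(a, b). {a, b} \<in> E}\<^sup>*" using connected assms by (simp add: connected_graph_def)
  then show ?thesis
  proof (induction rule: converse_rtrancl_induct)
    case base
    show ?case by (rule assms(3))
  next
    case (step y z)
    then have "{y, z} \<in> E" by simp
    moreover from this have "y \<in> V" "z \<in> V" using simple by (auto simp: simple_graph_def)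
    ultimately show ?case using step.IH perc_prob_neighbour by blast
  qed
qed

end

section \<open>Variation along dyadic times\<close>

text \<open>Each increment telescopes into steps of size one, and the resulting index ranges do not
  overlap.\<close>

lemma sum_abs_diff_subsequence_le:
  fixes a :: "nat \<Rightarrow> real" and j :: "nat \<Rightarrow> nat"
  assumes "\<And>i. i < n \<Longrightarrow> j i \<le> j (Suc i)" and "j n \<le> N"
  shows "(\<Sum>i<n. \<bar>a (j (Suc i)) - a (j i)\<bar>) \<le> (\<Sum>l<N. \<bar>a (Suc l) - a l\<bar>)"
proof -
  have tele: "\<bar>a m' - a m\<bar> \<le> (\<Sum>l\<in>{m..<m'}. \<bar>a (Suc l) - a l\<bar>)" if "m \<le> m'" for m m'
    using sum_Suc_diff'[OF that, of a] sum_abs[of "\<lambda>l. a (Suc l) - a l" "{m..<m'}"] by simp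
  have "(\<Sum>i<n. \<bar>a (j (Suc i)) - a (j i)\<bar>) \<le> (\<Sum>l<j n. \<bar>a (Suc l) - a l\<bar>)"
    using assms(1)
  proof (induction n)
    case (Suc n)
    have le: "j n \<le> j (Suc n)" using Suc.prems by simp
    have "(\<Sum>i<Suc n. \<bar>a (j (Suc i)) - a (j i)\<bar>)
        \<le> (\<Sum>l<j n. \<bar>a (Suc l) - a l\<bar>) + (\<Sum>l\<in>{j n..<j (Suc n)}. \<bar>a (Suc l) - a l\<bar>)"
      using Suc tele[OF le] by (simp add: add_mono)
    also have "\<dots> = (\<Sum>l<j (Suc n). \<bar>a (Suc l) - a l\<bar>)"
      using sum.atLeastLessThan_concat[OF le0 le, of "\<lambda>l. \<bar>a (Suc l) - a l\<bar>"]
      by (simp add: lessThan_atLeast0)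
    finally show ?case .
  qed (simp add: sum_nonneg)
  also have "\<dots> \<le> (\<Sum>l<N. \<bar>a (Suc l) - a l\<bar>)"
    using assms(2) by (intro sum_mono2) auto
  finally show ?thesis .
qed

section \<open>Dyadic times and limits along them\<close>

definition dyadic_floor :: "nat \<Rightarrow> real \<Rightarrow> real" where
  "dyadic_floor k t = real (nat \<lfloor>t * 2 ^ k\<rfloor>) / 2 ^ k"

definition dyadic_variation :: "(real \<Rightarrow> real) \<Rightarrow> nat \<Rightarrow> nat \<Rightarrow> real" where
  "dyadic_variation h L k = (\<Sum>i<L * 2 ^ k. \<bar>h (real (Suc i) / 2 ^ k) - h (real i / 2 ^ k)\<bar>)"

lemma dyadic_floor_bounds:
  assumes "0 \<le> t"
  shows "0 \<le> dyadic_floor k t" "dyadic_floor k t \<le> t" "t < dyadic_floor k t + 1 / 2 ^ k"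
proof -
  have "real (nat \<lfloor>t * 2 ^ k\<rfloor>) = of_int \<lfloor>t * 2 ^ k\<rfloor>" using assms by (simp add: of_nat_nat)
  moreover have "of_int \<lfloor>t * 2 ^ k\<rfloor> \<le> t * 2 ^ k" "t * 2 ^ k < of_int \<lfloor>t * 2 ^ k\<rfloor> + 1"
    by linarith+
  ultimately show "0 \<le> dyadic_floor k t" "dyadic_floor k t \<le> t" "t < dyadic_floor k t + 1 / 2 ^ k"
    using assms by (simp_all add: dyadic_floor_def field_simps)
qed

lemma dyadic_floor_index_le:
  assumes "t \<le> real L" shows "nat \<lfloor>t * 2 ^ k\<rfloor> \<le> L * 2 ^ k"
proof -
  have "\<lfloor>t * 2 ^ k\<rfloor> \<le> \<lfloor>real (L * 2 ^ k)\<rfloor>"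
    using assms by (intro floor_mono) simp
  then have "\<lfloor>t * 2 ^ k\<rfloor> \<le> int (L * 2 ^ k)" by (simp only: floor_of_nat)
  then show ?thesis by linarith
qed

lemma dyadic_floor_tendsto:
  assumes "0 \<le> t" shows "(\<lambda>k. dyadic_floor k t) \<longlonglongrightarrow> t"
proof (rule tendsto_sandwich[of "\<lambda>k. t - (1 / 2) ^ k" _ _ "\<lambda>_. t"])
  have "t - (1 / 2) ^ k \<le> dyadic_floor k t" for k
    using dyadic_floor_bounds(3)[OF assms, of k] by (simp add: power_one_over)
  then show "\<forall>\<^sub>F k in sequentially. t - (1 / 2) ^ k \<le> dyadic_floor k t" by simp
  show "\<forall>\<^sub>F k in sequentially. dyadic_floor k t \<le> t"
    using dyadic_floor_bounds(2)[OF assms] by simp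
  have "(\<lambda>k. t - (1 / 2) ^ k) \<longlonglongrightarrow> t - 0"
    by (intro tendsto_intros LIMSEQ_power_zero) simp
  then show "(\<lambda>k. t - (1 / 2) ^ k) \<longlonglongrightarrow> t" by simp
qed simp

lemma dyadic_variation_mono:
  "dyadic_variation h L k \<le> dyadic_variation h L (Suc k)"
proof -
  have "dyadic_variation h L k = (\<Sum>i<L * 2 ^ k. \<bar>h (real (2 * Suc i) / 2 ^ Suc k) - h (real (2 * i) / 2 ^ Suc k)\<bar>)"
    unfolding dyadic_variation_def by (intro sum.cong refl arg_cong[where f=abs] arg_cong2[where f="(-)"] arg_cong[where f=h])
      (simp_all add: field_simps)
  also have "\<dots> \<le> dyadic_variation h L (Suc k)"
    unfolding dyadic_variation_def
    by (rule sum_abs_diff_subsequence_le[of _ "\<lambda>i. 2 * i" _ "\<lambda>l. h (real l / 2 ^ Suc k)"]) auto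
  finally show ?thesis .
qed

text \<open>The dyadic floors of a fixed \<open>t\<close> increase with the level, so their
  successive increments are absolutely summable with sum at most \<open>K\<close>. For any finite
  partition, the sum at the dyadic floors is at most \<open>K\<close> at every level, and the bound
  passes to the limit.\<close>

lemma dyadic_limit_bounded_variation:
  fixes h :: "real \<Rightarrow> real"
  assumes K: "\<And>k. dyadic_variation h 1 k \<le> K"
  shows "t \<in> {0..1} \<Longrightarrow> convergent (\<lambda>k. h (dyadic_floor k t))"
    and "bounded_variation_on 0 1 (\<lambda>t. lim (\<lambda>k. h (dyadic_floor k t)))"
proof -
  show conv: "convergent (\<lambda>k. h (dyadic_floor k t))" if t: "t \<in> {0..1}" for t
  proof -
    have bnd: "(\<Sum>i<n. norm (h (dyadic_floor (Suc i) t) - h (dyadic_floor i t))) \<le> K" for n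
    proof -
      \<comment> \<open>The index, in the grid of level \<open>n\<close>, of the floor of
        \<open>t\<close> at level \<open>i\<close>; it turns increments across levels into
        increments within a single grid.\<close>
      define j where "j i = nat \<lfloor>t * 2 ^ i\<rfloor> * 2 ^ (n - i)" for i
      have dj: "dyadic_floor i t = real (j i) / 2 ^ n" if "i \<le> n" for i
      proof -
        have "(2::real) ^ n = 2 ^ i * 2 ^ (n - i)" using that by (simp flip: power_add)
        then show ?thesis by (simp add: dyadic_floor_def j_def)
      qed
      have mono: "j i \<le> j (Suc i)" if "i < n" for i
      proof -
        have "2 * \<lfloor>t * 2 ^ i\<rfloor> \<le> \<lfloor>t * 2 ^ Suc i\<rfloor>"
          by (simp add: le_floor_iff)
        then have "nat \<lfloor>t * 2 ^ i\<rfloor> * 2 \<le> nat \<lfloor>t * 2 ^ Suc i\<rfloor>" by linarith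
        then have "nat \<lfloor>t * 2 ^ i\<rfloor> * 2 * 2 ^ (n - Suc i) \<le> nat \<lfloor>t * 2 ^ Suc i\<rfloor> * 2 ^ (n - Suc i)"
          by (rule mult_le_mono1)
        moreover have "n - i = Suc (n - Suc i)" using that by simp
        ultimately show ?thesis by (simp only: j_def power_Suc mult.assoc)
      qed
      have "j n \<le> 1 * 2 ^ n" using dyadic_floor_index_le[of t 1 n] t by (simp add: j_def)
      from sum_abs_diff_subsequence_le[OF mono this, of "\<lambda>l. h (real l / 2 ^ n)"]
      have "(\<Sum>i<n. \<bar>h (real (j (Suc i)) / 2 ^ n) - h (real (j i) / 2 ^ n)\<bar>) \<le> dyadic_variation h 1 n"
        by (simp add: dyadic_variation_def)
      then show ?thesis using K[of n] by (simp add: dj)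
    qed
    have "summable (\<lambda>i. norm (h (dyadic_floor (Suc i) t) - h (dyadic_floor i t)))"
    proof (rule bounded_imp_summable[where B=K])
      show "(\<Sum>i\<le>n. norm (h (dyadic_floor (Suc i) t) - h (dyadic_floor i t))) \<le> K" for n
        using bnd[of "Suc n"] by (simp only: lessThan_Suc_atMost)
    qed simp
    then have "summable (\<lambda>i. h (dyadic_floor (Suc i) t) - h (dyadic_floor i t))"
      by (rule summable_norm_cancel)
    from summable_LIMSEQ[OF this]
    \<comment> \<open>The telescoped partial sums converge; adding back the value at level 0
      recovers the sequence itself.\<close>
    have "convergent (\<lambda>n. (h (dyadic_floor n t) - h (dyadic_floor 0 t)) + h (dyadic_floor 0 t))"
      by (intro convergent_add convergent_const) 
        (auto simp: sum_lessThan_telescope[of "\<lambda>i. h (dyadic_floor i t)"] convergent_def)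
    then show ?thesis by simp
  qed
  show "bounded_variation_on 0 1 (\<lambda>t. lim (\<lambda>k. h (dyadic_floor k t)))"
    unfolding bounded_variation_on_def
  proof (intro exI[of _ K] allI impI)
    fix n and t :: "nat \<Rightarrow> real"
    assume t: "(\<forall>i\<le>n. t i \<in> {0..1}) \<and> (\<forall>i<n. t i \<le> t (Suc i))"
    show "(\<Sum>i<n. \<bar>lim (\<lambda>k. h (dyadic_floor k (t (Suc i)))) - lim (\<lambda>k. h (dyadic_floor k (t i)))\<bar>) \<le> K"
    proof (rule LIMSEQ_le_const2)
      show "(\<lambda>k. \<Sum>i<n. \<bar>h (dyadic_floor k (t (Suc i))) - h (dyadic_floor k (t i))\<bar>)
        \<longlonglongrightarrow> (\<Sum>i<n. \<bar>lim (\<lambda>k. h (dyadic_floor k (t (Suc i)))) - lim (\<lambda>k. h (dyadic_floor k (t i)))\<bar>)"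
        using t by (intro tendsto_intros convergent_LIMSEQ_iff[THEN iffD1] conv) auto
      have "(\<Sum>i<n. \<bar>h (dyadic_floor k (t (Suc i))) - h (dyadic_floor k (t i))\<bar>) \<le> K" for k
      proof -
        have "(\<Sum>i<n. \<bar>h (dyadic_floor k (t (Suc i))) - h (dyadic_floor k (t i))\<bar>) \<le> dyadic_variation h 1 k"
          unfolding dyadic_variation_def dyadic_floor_def
        proof (rule sum_abs_diff_subsequence_le[of n "\<lambda>i. nat \<lfloor>t i * 2 ^ k\<rfloor>" _ "\<lambda>l. h (real l / 2 ^ k)"])
          show "nat \<lfloor>t i * 2 ^ k\<rfloor> \<le> nat \<lfloor>t (Suc i) * 2 ^ k\<rfloor>" if "i < n" for i
            using t that by (intro nat_mono floor_mono) simp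
          show "nat \<lfloor>t n * 2 ^ k\<rfloor> \<le> 1 * 2 ^ k"
            using t by (intro dyadic_floor_index_le) simp
        qed
        then show ?thesis using K[of k] by simp
      qed
      then show "\<exists>N. \<forall>k\<ge>N. (\<Sum>i<n. \<bar>h (dyadic_floor k (t (Suc i))) - h (dyadic_floor k (t i))\<bar>) \<le> K" by blast
    qed
  qed
qed

section \<open>Paths that are open at their jumps\<close>

lemma open_at_jumps_left_right:
  assumes "open_at_jumps \<xi>" "0 < t"
  obtains l r where "\<forall>\<^sub>F s in at_left t. \<xi> s = l" "\<forall>\<^sub>F s in at_right t. \<xi> s = r" "\<xi> t = (l \<or> r)"
  using assms unfolding open_at_jumps_def by blast

text \<open>This uses the convention at jumps: a closed value at \<open>t > 0\<close> forces both
  one-sided values to be closed.\<close>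

lemma open_at_jumps_closed_near:
  assumes "open_at_jumps \<xi>" "0 \<le> t" "\<not> \<xi> t"
  shows "\<forall>\<^sub>F s in at t within {0..}. \<not> \<xi> s"
proof (cases "t = 0")
  case True
  have "\<forall>\<^sub>F s in at_right 0. \<xi> s = \<xi> 0" using assms by (simp add: open_at_jumps_def)
  then have "\<forall>\<^sub>F s in at_right 0. \<not> \<xi> s" using assms(3) True by (auto elim: eventually_mono)
  then show ?thesis using True by (simp add: at_within_Ici_at_right)
next
  case False
  with assms(2) have "0 < t" by simp
  from open_at_jumps_left_right[OF assms(1) this] obtain l r where
    lr: "\<forall>\<^sub>F s in at_left t. \<xi> s = l" "\<forall>\<^sub>F s in at_right t. \<xi> s = r" "\<xi> t = (l \<or> r)" .
  have "\<not> l" "\<not> r" using lr(3) assms(3) by auto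
  then have "\<forall>\<^sub>F s in at t. \<not> \<xi> s" using lr(1,2) by (simp add: eventually_at_split)
  then show ?thesis by (rule filter_leD[OF at_le, rotated]) simp
qed

text \<open>The open times form a closed set, and each of them is a limit of intervals of open times
  on at least one side. Thus the path is determined by its rational times, which later supplies a
  jointly measurable version.\<close>

lemma open_at_jumps_iff_rational:
  assumes "open_at_jumps \<xi>" "0 \<le> t"
  shows "\<xi> t \<longleftrightarrow> (\<forall>n. \<exists>q::rat. 0 \<le> q \<and> \<bar>of_rat q - t\<bar> < 1 / Suc n \<and> \<xi> (of_rat q))"
proof
  assume "\<xi> t"
  show "\<forall>n. \<exists>q::rat. 0 \<le> q \<and> \<bar>of_rat q - t\<bar> < 1 / Suc n \<and> \<xi> (of_rat q)"
  proof
    fix n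
    have right: "\<exists>q::rat. 0 \<le> q \<and> \<bar>of_rat q - t\<bar> < 1 / Suc n \<and> \<xi> (of_rat q)"
      if ev: "\<forall>\<^sub>F s in at_right t. \<xi> s"
    proof -
      obtain b where b: "t < b" "\<And>s. t < s \<Longrightarrow> s < b \<Longrightarrow> \<xi> s"
        using ev by (auto simp: eventually_at_right_field)
      have "t < min b (t + 1 / Suc n)" using b(1) by simp
      then obtain q where "t < of_rat q" "of_rat q < min b (t + 1 / Suc n)"
        using of_rat_dense by blast
      moreover from this have "0 \<le> q" using assms(2) by (metis less_eq_real_def less_le_trans of_rat_less_eq of_rat_0 order_less_imp_le order_trans)
      ultimately show ?thesis using b by (intro exI[of _ q]) auto
    qed
    show "\<exists>q::rat. 0 \<le> q \<and> \<bar>of_rat q - t\<bar> < 1 / Suc n \<and> \<xi> (of_rat q)"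
    proof (cases "t = 0")
      case True
      have "\<forall>\<^sub>F s in at_right 0. \<xi> s = \<xi> 0" using assms by (simp add: open_at_jumps_def)
      then show ?thesis using \<open>\<xi> t\<close> True by (intro right) simp
    next
      case False
      with assms(2) have "0 < t" by simp
      from open_at_jumps_left_right[OF assms(1) this] obtain l r where
        lr: "\<forall>\<^sub>F s in at_left t. \<xi> s = l" "\<forall>\<^sub>F s in at_right t. \<xi> s = r" "\<xi> t = (l \<or> r)" .
      show ?thesis
      proof (cases r)
        case True
        then show ?thesis using lr(2) by (intro right) simp
      next
        case False
        then have "\<forall>\<^sub>F s in at_left t. \<xi> s" using lr \<open>\<xi> t\<close> by simp
        then obtain b where b: "b < t" "\<And>s. b < s \<Longrightarrow> s < t \<Longrightarrow> \<xi> s"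
          by (auto simp: eventually_at_left_field)
        \<comment> \<open>The lower bound 0 ensures that the chosen rational is nonnegative.\<close>
        have "max (max b (t - 1 / Suc n)) 0 < t" using b(1) \<open>0 < t\<close> by simp
        then obtain q where "max (max b (t - 1 / Suc n)) 0 < of_rat q" "of_rat q < t"
          using of_rat_dense by blast
        moreover from this have "0 \<le> q" by simp
        ultimately show ?thesis using b by (intro exI[of _ q]) auto
      qed
    qed
  qed
next
  assume Q: "\<forall>n. \<exists>q::rat. 0 \<le> q \<and> \<bar>of_rat q - t\<bar> < 1 / Suc n \<and> \<xi> (of_rat q)"
  show "\<xi> t"
  proof (rule ccontr)
    assume "\<not> \<xi> t"
    from open_at_jumps_closed_near[OF assms this] obtain d where
      d: "0 < d" "\<And>s. 0 \<le> s \<Longrightarrow> s \<noteq> t \<Longrightarrow> dist s t < d \<Longrightarrow> \<not> \<xi> s"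
      by (auto simp: eventually_at)
    obtain n where n: "1 / real (Suc n) < d" using nat_approx_posE[OF d(1)] .
    obtain q :: rat where q: "0 \<le> q" "\<bar>of_rat q - t\<bar> < 1 / Suc n" "\<xi> (of_rat q)" using Q by blast
    have "of_rat q \<noteq> t" using q(3) \<open>\<not> \<xi> t\<close> by auto
    then show False using d(2)[of "of_rat q"] q n by (auto simp: dist_real_def)
  qed
qed

section \<open>Dynamical percolation\<close>

locale dynamical_percolation_graph = percolation_graph V E p + M: prob_space M
  for V :: "'v set" and E :: "'v set set" and p :: "'v set \<Rightarrow> real" and M :: "'w measure" +
  fixes X :: "'v set \<Rightarrow> real \<Rightarrow> 'w \<Rightarrow> bool"
  assumes dyn: "dynamical_percolation M E p X"
begin

definition config :: "real \<Rightarrow> 'w \<Rightarrow> 'v set \<Rightarrow> bool" where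
  "config t w = (\<lambda>e\<in>E. X e t w)"

lemma edge_chain: "e \<in> E \<Longrightarrow> stationary_chain M (p e) (X e)"
  using dyn p01 by unfold_locales (auto simp: dynamical_percolation_def)

lemma edge_measurable: "e \<in> E \<Longrightarrow> 0 \<le> t \<Longrightarrow> X e t \<in> measurable M (count_space UNIV)"
  using stationary_chain.chain_measurable[OF edge_chain] .

text \<open>The pair of states at two times is a measurable function of the path, so independence of
  the paths gives independence of the pairs; the other conditions are stationarity and the switching
  bound of one edge.\<close>

lemma coupled:
  assumes "0 \<le> s" "s \<le> t"
  shows "coupled_configurations E p M (\<lambda>e. X e s) (\<lambda>e. X e t) (t - s)"
proof
  show "E \<noteq> {}" by (rule E_nonempty)
  have "M.indep_vars (\<lambda>_. \<Pi>\<^sub>M t\<in>{0..}. count_space UNIV) (\<lambda>e w. \<lambda>t\<in>{0..}. X e t w) E"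
    using dyn by (auto simp: dynamical_percolation_def)
  then have "M.indep_vars (\<lambda>_. count_space UNIV)
      (\<lambda>e w. (\<lambda>e \<xi>. (\<xi> s, \<xi> t)) e (\<lambda>t\<in>{0..}. X e t w)) E"
  proof (rule M.indep_vars_compose2)
    have "(\<lambda>\<xi>. \<xi> r) \<in> measurable (\<Pi>\<^sub>M t\<in>{0::real..}. count_space (UNIV :: bool set)) (count_space UNIV)"
      if "0 \<le> r" for r
      using that by (intro measurable_component_singleton) simp
    then have "(\<lambda>\<xi>. (\<xi> s, \<xi> t)) \<in> measurable (\<Pi>\<^sub>M t\<in>{0::real..}. count_space (UNIV :: bool set))
        (count_space UNIV \<Otimes>\<^sub>M count_space UNIV)"
      using assms by (intro measurable_Pair) auto
    then show "(\<lambda>\<xi>. (\<xi> s, \<xi> t)) \<in> measurable (\<Pi>\<^sub>M t\<in>{0::real..}. count_space (UNIV :: bool set))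
        (count_space UNIV)"
      by (simp add: pair_measure_countable)
  qed
  then show "M.indep_vars (\<lambda>_. count_space UNIV) (\<lambda>e w. (X e s w, X e t w)) E"
    using assms by simp
  fix e assume e: "e \<in> E"
  interpret stationary_chain M "p e" "X e" using edge_chain[OF e] .
  show "distr M (count_space UNIV) (X e s) = measure_pmf (bernoulli_pmf (p e))"
    "distr M (count_space UNIV) (X e t) = measure_pmf (bernoulli_pmf (p e))"
    using assms by (auto intro: chain_law)
  show "measure M {w \<in> space M. X e s w \<noteq> X e t w} \<le> t - s"
    using assms by (rule chain_change)
qed (use assms in simp)

text \<open>Coupling time \<open>t\<close> with itself reduces the law of a single configuration to
  \<open>hybrid_law\<close>.\<close>

lemma config_eq_hybrid:
  "config t = coupled_configurations.hybrid E (\<lambda>e. X e t) (\<lambda>e. X e t) {}" if "0 \<le> t"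
proof -
  interpret coupled_configurations E p M "\<lambda>e. X e t" "\<lambda>e. X e t" "t - t"
    using that by (intro coupled) simp_all
  show ?thesis by (auto simp: config_def hybrid_def fun_eq_iff)
qed

lemma config_measurable:
  assumes "0 \<le> t" shows "config t \<in> measurable M \<mu>"
  using measurable_config[OF edge_measurable[OF _ assms]] by (simp add: config_def[abs_def])

lemma config_law:
  assumes "0 \<le> t" shows "distr M \<mu> (config t) = \<mu>"
proof -
  interpret coupled_configurations E p M "\<lambda>e. X e t" "\<lambda>e. X e t" "t - t"
    using assms by (intro coupled) simp_all
  show ?thesis unfolding config_eq_hybrid[OF assms] by (rule hybrid_law)
qed

lemma integral_config:
  fixes \<phi> :: "_ \<Rightarrow> real"
  assumes "0 \<le> t" "\<phi> \<in> borel_measurable \<mu>"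
  shows "(\<integral>w. \<phi> (config t w) \<partial>M) = (\<integral>\<eta>. \<phi> \<eta> \<partial>\<mu>)"
  using integral_distr[OF config_measurable[OF assms(1)] assms(2)] by (simp add: config_law[OF assms(1)])

lemma observable_config_measurable:
  assumes "observable \<phi>" "0 \<le> t" shows "(\<lambda>w. \<phi> (config t w)) \<in> borel_measurable M"
  using measurable_compose[OF config_measurable[OF assms(2)] observableD(1)[OF assms(1)]] .

lemma integrable_config:
  assumes "observable \<phi>" "0 \<le> t" shows "integrable M (\<lambda>w. \<phi> (config t w))"
  using observable_config_measurable[OF assms] observableD(4)[OF assms(1)]
  by (intro M.integrable_const_bound[where B=1]) auto

lemma config_dist_le:
  assumes "observable \<phi>" "locally_approximable \<phi>" "obs_influence \<phi> summable_on E" "0 \<le> s" "s \<le> t"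
  shows "(\<integral>w. \<bar>\<phi> (config t w) - \<phi> (config s w)\<bar> \<partial>M) \<le> (t - s) * infsum (obs_influence \<phi>) E"
  using coupled_configurations.integral_dist_le[OF coupled[OF assms(4,5)] assms(1-3)]
  by (simp add: config_def abs_minus_commute)

lemma integrable_dyadic_variation:
  assumes "observable \<phi>"
  shows "integrable M (\<lambda>w. dyadic_variation (\<lambda>t. \<phi> (config t w)) L k)"
  unfolding dyadic_variation_def using integrable_config[OF assms] by simp

text \<open>There are \<open>L * 2 ^ k\<close> increments, each over time \<open>1 / 2 ^ k\<close>,
  so the bound is the same for every level \<open>k\<close>.\<close>

lemma integral_dyadic_variation_le:
  assumes \<phi>: "observable \<phi>" "locally_approximable \<phi>" "obs_influence \<phi> summable_on E"
  shows "(\<integral>w. dyadic_variation (\<lambda>t. \<phi> (config t w)) L k \<partial>M) \<le> real L * infsum (obs_influence \<phi>) E"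
proof -
  have "(\<integral>w. dyadic_variation (\<lambda>t. \<phi> (config t w)) L k \<partial>M)
      = (\<Sum>i<L * 2 ^ k. \<integral>w. \<bar>\<phi> (config (real (Suc i) / 2 ^ k) w) - \<phi> (config (real i / 2 ^ k) w)\<bar> \<partial>M)"
    unfolding dyadic_variation_def using integrable_config[OF \<phi>(1)] by simp
  also have "\<dots> \<le> (\<Sum>i<L * 2 ^ k. 1 / 2 ^ k * infsum (obs_influence \<phi>) E)"
  proof (rule sum_mono)
    fix i
    have "real (Suc i) / 2 ^ k - real i / 2 ^ k = 1 / 2 ^ k" by (simp add: field_simps)
    then show "(\<integral>w. \<bar>\<phi> (config (real (Suc i) / 2 ^ k) w) - \<phi> (config (real i / 2 ^ k) w)\<bar> \<partial>M)
        \<le> 1 / 2 ^ k * infsum (obs_influence \<phi>) E"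
      using config_dist_le[OF \<phi>, of "real i / 2 ^ k" "real (Suc i) / 2 ^ k"]
      by (simp add: divide_right_mono)
  qed
  also have "\<dots> = real L * infsum (obs_influence \<phi>) E" by simp
  finally show ?thesis .
qed

lemma AE_open_at_jumps: "AE w in M. \<forall>e\<in>E. open_at_jumps (\<lambda>t. X e t w)"
  using dyn countable_E
  by (subst AE_ball_countable) (auto simp: dynamical_percolation_def two_state_chain_def)

text \<open>Non-percolation is witnessed by a finite boundary of closed edges outside
  \<open>F\<close>. Each of them stays closed for a while around \<tau>, hence all of them do
  simultaneously.\<close>

lemma not_percolates_near:
  assumes jumps: "\<forall>e\<in>E. open_at_jumps (\<lambda>t. X e t w)" and "0 \<le> \<tau>" and x: "x \<in> V"
    and np: "\<not> percolates E (\<lambda>e. X e \<tau> w \<or> e \<in> F) x"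
  shows "\<forall>\<^sub>F s in at \<tau> within {0..}. \<not> percolates E (\<lambda>e. X e s w \<or> e \<in> F) x"
proof -
  obtain C where C: "C \<in> finite_sets_around V x"
    and closed: "\<And>e. e \<in> edge_boundary E C \<Longrightarrow> \<not> X e \<tau> w \<and> e \<notin> F"
    using np unfolding percolates_iff_boundary[OF simple x] by blast
  have "\<forall>\<^sub>F s in at \<tau> within {0..}. \<forall>e\<in>edge_boundary E C. \<not> X e s w"
  proof (rule eventually_ball_finite[OF finite_edge_boundary[OF C]], rule ballI)
    fix e assume e: "e \<in> edge_boundary E C"
    then have "open_at_jumps (\<lambda>t. X e t w)" using jumps edge_boundary_subset by blast
    then show "\<forall>\<^sub>F s in at \<tau> within {0..}. \<not> X e s w"
      using closed[OF e] \<open>0 \<le> \<tau>\<close> by (intro open_at_jumps_closed_near) auto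
  qed
  then show ?thesis
  proof (rule eventually_mono)
    fix s assume "\<forall>e\<in>edge_boundary E C. \<not> X e s w"
    then have "\<not> (\<exists>e\<in>edge_boundary E C. X e s w \<or> e \<in> F)" using closed by blast
    then show "\<not> percolates E (\<lambda>e. X e s w \<or> e \<in> F) x"
      unfolding percolates_iff_boundary[OF simple x] using C by blast
  qed
qed

text \<open>If every vertex percolated with probability 0, then by countability of \<open>V\<close>
  almost surely none would percolate at \<open>t\<^sub>0\<close>. Positivity at one vertex then
  spreads along paths to \<open>x\<close>.\<close>

lemma percolation_prob_pos:
  assumes t0: "0 \<le> t\<^sub>0" "AE w in M. \<exists>v\<in>V. percolates E (\<lambda>e. X e t\<^sub>0 w) v" and x: "x \<in> V"
  shows "0 < (\<integral>\<eta>. perc x \<eta> \<partial>\<mu>)"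
proof -
  have "\<exists>v\<in>V. 0 < (\<integral>\<eta>. perc v \<eta> \<partial>\<mu>)"
  proof (rule ccontr)
    assume none: "\<not> ?thesis"
    have "AE w in M. perc v (config t\<^sub>0 w) = 0" if v: "v \<in> V" for v
    proof -
      note obs = observable_perc[OF v]
      have "0 \<le> (\<integral>\<eta>. perc v \<eta> \<partial>\<mu>)" by (simp add: perc_def)
      with none v have "(\<integral>\<eta>. perc v \<eta> \<partial>\<mu>) = 0" by force
      then have "(\<integral>w. perc v (config t\<^sub>0 w) \<partial>M) = 0"
        using integral_config[OF t0(1) observableD(1)[OF obs]] by simp
      then show ?thesis
        using integral_nonneg_eq_0_iff_AE[OF integrable_config[OF obs t0(1)]] by (simp add: perc_def)
    qed
    then have "AE w in M. \<forall>v\<in>V. perc v (config t\<^sub>0 w) = 0"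
      using countable_V by (simp add: AE_ball_countable)
    then have "AE w in M. False"
      using t0(2) by eventually_elim (auto simp: config_def perc_restrict, simp add: perc_def)
    then show False by simp
  qed
  then show ?thesis using perc_prob_pos x by blast
qed

end

section \<open>Exceptional times\<close>

lemma summable_on_tail_bound:
  fixes f :: "'a \<Rightarrow> real"
  assumes f: "f summable_on A" "\<And>a. a \<in> A \<Longrightarrow> 0 \<le> f a" and "0 < \<epsilon>"
  obtains F where "finite F" "F \<subseteq> A"
    "\<And>G. finite G \<Longrightarrow> F \<subseteq> G \<Longrightarrow> G \<subseteq> A \<Longrightarrow> infsum f A - \<epsilon> < sum f G"
proof -
  have "(sum f \<longlongrightarrow> infsum f A) (finite_subsets_at_top A)"
    using has_sum_infsum[OF f(1)] by (simp add: has_sum_def)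
  then have "\<forall>\<^sub>F G in finite_subsets_at_top A. infsum f A - \<epsilon> < sum f G"
    using \<open>0 < \<epsilon>\<close> by (intro order_tendstoD) auto
  then obtain F where "finite F" "F \<subseteq> A"
    "\<forall>G. finite G \<and> F \<subseteq> G \<and> G \<subseteq> A \<longrightarrow> infsum f A - \<epsilon> < sum f G"
    unfolding eventually_finite_subsets_at_top by (elim exE conjE)
  then show ?thesis by (intro that[of F]) simp_all
qed

lemma infsum_tail_le:
  fixes f g :: "'a \<Rightarrow> real"
  assumes f: "f summable_on A" "\<And>a. a \<in> A \<Longrightarrow> 0 \<le> f a"
    and G: "finite G" "G \<subseteq> A" "infsum f A - \<epsilon> < sum f G"
    and g: "\<And>a. a \<in> A \<Longrightarrow> 0 \<le> g a" "\<And>a. a \<in> A \<Longrightarrow> g a \<le> (if a \<in> G then 0 else f a)"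
  shows "g summable_on A" "infsum g A \<le> \<epsilon>"
proof -
  have le: "sum g F \<le> \<epsilon>" if F: "finite F" "F \<subseteq> A" for F
  proof -
    have "sum g F \<le> (\<Sum>a\<in>F. if a \<in> G then 0 else f a)"
      by (intro sum_mono g(2) subsetD[OF F(2)])
    also have "\<dots> = sum f (F - G)"
      using F(1) by (simp add: sum.If_cases Diff_eq Compl_eq)
    also have "\<dots> = sum f ((F - G) \<union> G) - sum f G"
      using F(1) G(1) by (subst sum.union_disjoint) auto
    also have "sum f ((F - G) \<union> G) \<le> infsum f A"
      using F G f by (intro finite_sum_le_infsum) auto
    finally show ?thesis using G(3) by simp
  qed
  show "g summable_on A"
    using g(1) le by (intro nonneg_bdd_above_summable_on bdd_aboveI2[where M=\<epsilon>]) auto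
  then show "infsum g A \<le> \<epsilon>" using le by (intro infsum_le_finite_sums)
qed

context dynamical_percolation_graph
begin

text \<open>One finite set makes the tail of the influences small, another forces concentration at
  the mean. Both properties survive enlarging the set, so resampling the union achieves them
  together.\<close>

lemma exists_low_influence_resampling:
  assumes x: "x \<in> V" and sum: "obs_influence (perc x) summable_on E" and "0 < \<epsilon>"
  obtains es where "set es \<subseteq> E" "obs_influence (resample_list es (perc x)) summable_on E"
    "infsum (obs_influence (resample_list es (perc x))) E \<le> \<epsilon>"
    "(\<integral>\<eta>. \<bar>resample_list es (perc x) \<eta> - (\<integral>\<eta>. perc x \<eta> \<partial>\<mu>)\<bar> \<partial>\<mu>) < \<epsilon>"
proof -
  note obs = observable_perc[OF x]
  obtain F1 where F1: "finite F1" "F1 \<subseteq> E"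
    "\<And>G. finite G \<Longrightarrow> F1 \<subseteq> G \<Longrightarrow> G \<subseteq> E \<Longrightarrow>
      infsum (obs_influence (perc x)) E - \<epsilon> < sum (obs_influence (perc x)) G"
    by (rule summable_on_tail_bound[OF sum obs_influence_nonneg \<open>0 < \<epsilon>\<close>]) (rule that)
  obtain F2 where F2: "finite F2" "F2 \<subseteq> E"
    "\<And>es. F2 \<subseteq> set es \<Longrightarrow> set es \<subseteq> E \<Longrightarrow>
      (\<integral>\<eta>. \<bar>resample_list es (perc x) \<eta> - (\<integral>\<eta>. perc x \<eta> \<partial>\<mu>)\<bar> \<partial>\<mu>) < \<epsilon>"
    by (rule resample_list_concentrates[OF obs locally_approximable_perc[OF x] \<open>0 < \<epsilon>\<close>]) (rule that)
  obtain es where es: "set es = F1 \<union> F2" using finite_list[of "F1 \<union> F2"] F1(1) F2(1) by auto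
  have "set es \<subseteq> E" using es F1(2) F2(2) by simp
  have tail: "infsum (obs_influence (perc x)) E - \<epsilon> < sum (obs_influence (perc x)) (set es)"
    by (rule F1(3)[OF finite_set]) (use es \<open>set es \<subseteq> E\<close> in simp_all)
  note tail_le = infsum_tail_le[OF sum obs_influence_nonneg finite_set \<open>set es \<subseteq> E\<close> tail
      obs_influence_nonneg resample_list_props(3)[OF obs \<open>set es \<subseteq> E\<close>]]
  show ?thesis
    by (rule that[OF \<open>set es \<subseteq> E\<close> tail_le F2(3)]) (use es F1(1,2) F2(1,2) in auto)
qed

lemma resampled_vanishes_near_exceptional:
  assumes jumps: "\<forall>e\<in>E. open_at_jumps (\<lambda>t. X e t w)" and \<tau>: "0 \<le> \<tau>" and x: "x \<in> V"
    and exc: "\<And>v. v \<in> V \<Longrightarrow> \<not> percolates E (\<lambda>e. X e \<tau> w) v" and es: "set es \<subseteq> E"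
  shows "\<forall>\<^sub>F k in sequentially. resample_list es (perc x) (config (dyadic_floor k \<tau>) w) = 0"
proof -
  have np: "\<not> percolates E (\<lambda>e. X e \<tau> w \<or> e \<in> set es) x"
    by (rule not_percolates_finite_opening[OF simple finite_set es exc x])
  \<comment> \<open>A dyadic floor may equal \<tau>, so the point \<tau> itself is included, where
    non-percolation holds by \<open>np\<close>.\<close>
  have "\<forall>\<^sub>F s in nhds \<tau>. s \<in> {0..} \<longrightarrow> \<not> percolates E (\<lambda>e. X e s w \<or> e \<in> set es) x"
    using not_percolates_near[OF jumps \<tau> x np] np unfolding eventually_at_filter
    by (auto elim!: eventually_mono)
  from eventually_compose_filterlim[OF this dyadic_floor_tendsto[OF \<tau>]]
  show ?thesis
  proof (rule eventually_mono)
    fix k assume "dyadic_floor k \<tau> \<in> {0..} \<longrightarrow> \<not> percolates E (\<lambda>e. X e (dyadic_floor k \<tau>) w \<or> e \<in> set es) x"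
    then have "\<not> percolates E (\<lambda>e. X e (dyadic_floor k \<tau>) w \<or> e \<in> set es) x"
      using dyadic_floor_bounds(1)[OF \<tau>] by simp
    then have "\<not> percolates E (\<lambda>e. config (dyadic_floor k \<tau>) w e \<or> e \<in> set es) x"
    proof (rule contrapos_nn)
      assume "percolates E (\<lambda>e. config (dyadic_floor k \<tau>) w e \<or> e \<in> set es) x"
      then show "percolates E (\<lambda>e. X e (dyadic_floor k \<tau>) w \<or> e \<in> set es) x"
        by (rule percolates_mono) (simp add: config_def)
    qed
    then show "resample_list es (perc x) (config (dyadic_floor k \<tau>) w) = 0"
      by (rule contrapos_np) (rule resample_list_perc_nonzero)
  qed
qed

text \<open>A zero at a dyadic time requires an initial deviation from \<theta> and a variation that
  sum to at least \<theta>. Their expectations are at most \<epsilon> and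
  \<open>L * \<epsilon>\<close>, and Markov's inequality finishes.\<close>

lemma prob_dyadic_zero_le:
  assumes \<phi>: "observable \<phi>" "locally_approximable \<phi>" "obs_influence \<phi> summable_on E"
    and small: "infsum (obs_influence \<phi>) E \<le> \<epsilon>" "(\<integral>\<eta>. \<bar>\<phi> \<eta> - \<theta>\<bar> \<partial>\<mu>) < \<epsilon>" and "0 < \<theta>"
  shows "M.prob {w \<in> space M. \<exists>i\<in>{..L * 2 ^ k}. \<phi> (config (real i / 2 ^ k) w) = 0} \<le> (1 + real L) * \<epsilon> / \<theta>"
proof -
  define D where "D w = \<bar>\<phi> (config 0 w) - \<theta>\<bar> + dyadic_variation (\<lambda>t. \<phi> (config t w)) L k" for w
  have int0: "integrable M (\<lambda>w. \<bar>\<phi> (config 0 w) - \<theta>\<bar>)" using integrable_config[OF \<phi>(1)] by simp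
  note intV = integrable_dyadic_variation[OF \<phi>(1), of L k]
  have int: "integrable M D" unfolding D_def[abs_def] using int0 intV by simp
  have D_nonneg: "0 \<le> D w" for w by (simp add: D_def dyadic_variation_def sum_nonneg)
  have D_ge: "\<theta> \<le> D w" if "i \<le> L * 2 ^ k" "\<phi> (config (real i / 2 ^ k) w) = 0" for i w
  proof -
    have "\<bar>\<phi> (config (real i / 2 ^ k) w) - \<phi> (config 0 w)\<bar> \<le> dyadic_variation (\<lambda>t. \<phi> (config t w)) L k"
      using sum_abs_diff_subsequence_le[of 1 "\<lambda>n. if n = 0 then 0 else i" "L * 2 ^ k"
          "\<lambda>l. \<phi> (config (real l / 2 ^ k) w)"] that(1)
      by (simp add: dyadic_variation_def)
    then show ?thesis using that(2) unfolding D_def by linarith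
  qed
  have "M.prob {w \<in> space M. \<exists>i\<in>{..L * 2 ^ k}. \<phi> (config (real i / 2 ^ k) w) = 0}
      \<le> M.prob {w \<in> space M. \<theta> \<le> D w}"
  proof (rule M.finite_measure_mono)
    show "{w \<in> space M. \<theta> \<le> D w} \<in> M.events" using borel_measurable_integrable[OF int] by measurable
  qed (use D_ge in auto)
  also have "\<dots> \<le> (\<integral>w. D w \<partial>M) / \<theta>"
    by (rule integral_Markov_inequality_measure[OF int sets.empty_sets]) (use D_nonneg \<open>0 < \<theta>\<close> in auto)
  also have "(\<integral>w. D w \<partial>M) \<le> (1 + real L) * \<epsilon>"
  proof -
    have "(\<integral>w. D w \<partial>M) = (\<integral>w. \<bar>\<phi> (config 0 w) - \<theta>\<bar> \<partial>M)
        + (\<integral>w. dyadic_variation (\<lambda>t. \<phi> (config t w)) L k \<partial>M)"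
      unfolding D_def using int0 intV by simp
    also have "(\<integral>w. \<bar>\<phi> (config 0 w) - \<theta>\<bar> \<partial>M) = (\<integral>\<eta>. \<bar>\<phi> \<eta> - \<theta>\<bar> \<partial>\<mu>)"
      using observableD(1)[OF \<phi>(1)] by (intro integral_config) auto
    also have "(\<integral>w. dyadic_variation (\<lambda>t. \<phi> (config t w)) L k \<partial>M) \<le> real L * \<epsilon>"
      using integral_dyadic_variation_le[OF \<phi>, of L k] mult_left_mono[OF small(1), of "real L"] by simp
    finally show ?thesis using small(2) by (simp add: algebra_simps)
  qed
  finally show ?thesis using \<open>0 < \<theta>\<close> by (simp add: divide_right_mono)
qed

definition exceptional :: "nat \<Rightarrow> 'w \<Rightarrow> bool" where
  "exceptional L w \<longleftrightarrow> (\<exists>\<tau>. 0 \<le> \<tau> \<and> \<tau> \<le> real L \<and> (\<forall>v\<in>V. \<not> percolates E (\<lambda>e. X e \<tau> w) v))"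

text \<open>Measurability of the set of \<omega> with an exceptional time is not assumed, so that
  set is covered by an event of small probability.\<close>

lemma exceptional_times_small:
  assumes x: "x \<in> V" and sum: "obs_influence (perc x) summable_on E"
    and pos: "0 < (\<integral>\<eta>. perc x \<eta> \<partial>\<mu>)" and "0 < \<delta>"
  obtains U where "U \<in> M.events" "M.prob U \<le> \<delta>"
    "\<And>w. w \<in> space M \<Longrightarrow> \<forall>e\<in>E. open_at_jumps (\<lambda>t. X e t w) \<Longrightarrow> exceptional L w \<Longrightarrow> w \<in> U"
proof -
  let ?\<theta> = "\<integral>\<eta>. perc x \<eta> \<partial>\<mu>"
  \<comment> \<open>Chosen so that the Markov bound \<open>(1 + L) * \<epsilon> / \<theta>\<close>
    equals \<delta>.\<close>
  define \<epsilon> where "\<epsilon> = \<delta> * ?\<theta> / (1 + real L)"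
  have "0 < \<epsilon>" using pos \<open>0 < \<delta>\<close> by (simp add: \<epsilon>_def)
  have \<epsilon>: "(1 + real L) * \<epsilon> / ?\<theta> = \<delta>" using pos by (simp add: \<epsilon>_def)
  obtain es where es: "set es \<subseteq> E" "obs_influence (resample_list es (perc x)) summable_on E"
    "infsum (obs_influence (resample_list es (perc x))) E \<le> \<epsilon>"
    "(\<integral>\<eta>. \<bar>resample_list es (perc x) \<eta> - ?\<theta>\<bar> \<partial>\<mu>) < \<epsilon>"
    by (rule exists_low_influence_resampling[OF x sum \<open>0 < \<epsilon>\<close>]) (rule that)
  define \<phi> where "\<phi> = resample_list es (perc x)"
  have \<phi>: "observable \<phi>" "locally_approximable \<phi>"
    using resample_list_props(1,2)[OF observable_perc[OF x] es(1)] locally_approximable_perc[OF x]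
    by (auto simp: \<phi>_def)
  define B where "B k = {w \<in> space M. \<exists>i\<in>{..L * 2 ^ k}. \<phi> (config (real i / 2 ^ k) w) = 0}" for k
  have B_sets: "B k \<in> M.events" for k
    unfolding B_def
  proof (rule sets.sets_Collect_finite_Ex)
    fix i
    have "(\<lambda>w. \<phi> (config (real i / 2 ^ k) w)) \<in> borel_measurable M"
      by (rule observable_config_measurable[OF \<phi>(1)]) simp
    then show "{w \<in> space M. \<phi> (config (real i / 2 ^ k) w) = 0} \<in> M.events" by measurable
  qed simp
  \<comment> \<open>Grids refine with \<open>k\<close>, so the bound \<delta>, which is uniform in
    \<open>k\<close>, carries over to the union of all levels.\<close>
  have "incseq B"
  proof (rule incseq_SucI, rule subsetI)
    fix k w assume "w \<in> B k"
    then obtain i where i: "w \<in> space M" "i \<le> L * 2 ^ k" "\<phi> (config (real i / 2 ^ k) w) = 0"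
      by (auto simp: B_def)
    have "real (2 * i) / 2 ^ Suc k = real i / 2 ^ k" by simp
    then have "2 * i \<in> {..L * 2 ^ Suc k} \<and> \<phi> (config (real (2 * i) / 2 ^ Suc k) w) = 0"
      using i(2,3) by simp
    then show "w \<in> B (Suc k)" using i(1) unfolding B_def by blast
  qed
  have B_prob: "M.prob (B k) \<le> \<delta>" for k
    using prob_dyadic_zero_le[OF \<phi> es(2)[folded \<phi>_def] es(3)[folded \<phi>_def] es(4)[folded \<phi>_def] pos, of L k]
    by (simp only: B_def \<epsilon>)
  show ?thesis
  proof (rule that[of "\<Union>k. B k"])
    show "(\<Union>k. B k) \<in> M.events" using B_sets by auto
    have "(\<lambda>k. M.prob (B k)) \<longlonglongrightarrow> M.prob (\<Union>k. B k)"
      using B_sets \<open>incseq B\<close> by (intro M.finite_Lim_measure_incseq) auto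
    then show "M.prob (\<Union>k. B k) \<le> \<delta>" using B_prob by (intro LIMSEQ_le_const2) auto
    fix w assume w: "w \<in> space M" "\<forall>e\<in>E. open_at_jumps (\<lambda>t. X e t w)" and "exceptional L w"
    then obtain \<tau> where \<tau>: "0 \<le> \<tau>" "\<tau> \<le> real L"
      and exc: "\<And>v. v \<in> V \<Longrightarrow> \<not> percolates E (\<lambda>e. X e \<tau> w) v"
      unfolding exceptional_def by blast
    obtain k where "\<phi> (config (dyadic_floor k \<tau>) w) = 0"
      using resampled_vanishes_near_exceptional[OF w(2) \<tau>(1) x exc es(1)]
      by (auto simp: eventually_sequentially \<phi>_def)
    then have "w \<in> B k"
      using w(1) dyadic_floor_index_le[OF \<tau>(2), of k] unfolding B_def dyadic_floor_def by blast
    then show "w \<in> (\<Union>k. B k)" by blast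
  qed
qed

text \<open>For each horizon \<open>L\<close>, intersecting covers of probability at most
  \<open>1 / Suc j\<close> gives a null event containing the exceptional outcomes with well-behaved
  paths; countably many horizons exhaust all times.\<close>

theorem no_exceptional_times:
  assumes x: "x \<in> V" and sum: "obs_influence (perc x) summable_on E"
    and pos: "0 < (\<integral>\<eta>. perc x \<eta> \<partial>\<mu>)"
  shows "AE w in M. \<forall>t\<ge>0. \<exists>v\<in>V. percolates E (\<lambda>e. X e t w) v"
proof -
  have "AE w in M. \<forall>t. 0 \<le> t \<and> t \<le> real L \<longrightarrow> (\<exists>v\<in>V. percolates E (\<lambda>e. X e t w) v)" for L
  proof -
    let ?Q = "\<lambda>j U. U \<in> M.events \<and> M.prob U \<le> 1 / Suc j \<and>
        (\<forall>w\<in>space M. (\<forall>e\<in>E. open_at_jumps (\<lambda>t. X e t w)) \<longrightarrow> exceptional L w \<longrightarrow> w \<in> U)"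
    have "\<exists>U. ?Q j U" for j
    proof -
      have "0 < 1 / real (Suc j)" by simp
      from exceptional_times_small[OF x sum pos this, of L] show ?thesis by metis
    qed
    then have "\<forall>j. \<exists>U. ?Q j U" by (rule allI)
    from choice[OF this] obtain U where "\<forall>j. ?Q j (U j)" ..
    then have U: "\<And>j. U j \<in> M.events" "\<And>j. M.prob (U j) \<le> 1 / Suc j"
      "\<And>j w. w \<in> space M \<Longrightarrow> \<forall>e\<in>E. open_at_jumps (\<lambda>t. X e t w) \<Longrightarrow> exceptional L w \<Longrightarrow> w \<in> U j"
      by simp_all
    have N: "(\<Inter>j. U j) \<in> M.events" using U(1) by auto
    have "M.prob (\<Inter>j. U j) \<le> 1 / Suc j" for j
      using M.finite_measure_mono[OF _ U(1), of "\<Inter>j. U j" j] U(2)[of j] by force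
    then have "M.prob (\<Inter>j. U j) \<le> 0"
      using LIMSEQ_inverse_real_of_nat by (intro LIMSEQ_le_const[of _ 0]) (auto simp: inverse_eq_divide)
    then have "emeasure M (\<Inter>j. U j) = 0"
      by (simp add: M.emeasure_eq_measure measure_le_0_iff)
    then have "(\<Inter>j. U j) \<in> null_sets M" using N by (simp add: null_sets_def)
    then have "AE w in M. w \<notin> (\<Inter>j. U j)" by (rule AE_not_in)
    with AE_open_at_jumps show ?thesis
      using AE_space by eventually_elim (use U(3) in \<open>unfold exceptional_def, blast\<close>)
  qed
  then have "AE w in M. \<forall>L. \<forall>t. 0 \<le> t \<and> t \<le> real L \<longrightarrow> (\<exists>v\<in>V. percolates E (\<lambda>e. X e t w) v)"
    by (simp add: AE_all_countable)
  then show ?thesis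
    by eventually_elim (use real_arch_simple in blast)
qed

end

section \<open>Bounded variation\<close>

context dynamical_percolation_graph
begin

text \<open>The dyadic variations increase with the level and have bounded means, so by monotone
  convergence their supremum is integrable and almost surely finite.\<close>

lemma AE_dyadic_variation_bounded:
  assumes \<phi>: "observable \<phi>" "locally_approximable \<phi>" "obs_influence \<phi> summable_on E"
  shows "AE w in M. \<exists>K. \<forall>k. dyadic_variation (\<lambda>t. \<phi> (config t w)) L k \<le> K"
proof -
  define D where "D k w = dyadic_variation (\<lambda>t. \<phi> (config t w)) L k" for k w
  have int: "integrable M (D k)" for k
    unfolding D_def[abs_def] by (rule integrable_dyadic_variation[OF \<phi>(1)])
  note [measurable] = borel_measurable_integrable[OF int]
  have nn: "0 \<le> D k w" for k w by (simp add: D_def dyadic_variation_def sum_nonneg)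
  have inc: "incseq (\<lambda>k w. ennreal (D k w))"
    unfolding D_def by (intro incseq_SucI le_funI ennreal_leI dyadic_variation_mono)
  have "(\<integral>\<^sup>+w. (SUP k. ennreal (D k w)) \<partial>M) = (SUP k. \<integral>\<^sup>+w. ennreal (D k w) \<partial>M)"
    using inc by (rule nn_integral_monotone_convergence_SUP) measurable
  also have "\<dots> \<le> ennreal (real L * infsum (obs_influence \<phi>) E)"
  proof (rule SUP_least)
    fix k
    have "(\<integral>\<^sup>+w. ennreal (D k w) \<partial>M) = ennreal (\<integral>w. D k w \<partial>M)"
      using int nn by (intro nn_integral_eq_integral) auto
    also have "\<dots> \<le> ennreal (real L * infsum (obs_influence \<phi>) E)"
      unfolding D_def by (intro ennreal_leI integral_dyadic_variation_le \<phi>)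
    finally show "(\<integral>\<^sup>+w. ennreal (D k w) \<partial>M) \<le> ennreal (real L * infsum (obs_influence \<phi>) E)" .
  qed
  also have "\<dots> < \<infinity>" by simp
  finally have "AE w in M. (SUP k. ennreal (D k w)) \<noteq> \<infinity>"
    by (intro nn_integral_noteq_infinite) auto
  then show ?thesis
  proof eventually_elim
    fix w assume fin: "(SUP k. ennreal (D k w)) \<noteq> \<infinity>"
    have "D k w \<le> enn2real (SUP k. ennreal (D k w))" for k
    proof -
      have "ennreal (D k w) \<le> (SUP k. ennreal (D k w))" by (rule SUP_upper) simp
      then have "enn2real (ennreal (D k w)) \<le> enn2real (SUP k. ennreal (D k w))"
        using fin by (intro enn2real_mono) (simp_all only: infinity_ennreal_def less_top)
      then show ?thesis using nn by simp
    qed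
    then show "\<exists>K. \<forall>k. dyadic_variation (\<lambda>t. \<phi> (config t w)) L k \<le> K"
      unfolding D_def by blast
  qed
qed

text \<open>\<open>lim\<close> has an arbitrary value where the sequence diverges; for
  \<open>t\<close> in \<open>[0, 1]\<close> this happens only with probability 0 under summable
  influences.\<close>

definition dyadic_limit :: "'v \<Rightarrow> real \<Rightarrow> 'w \<Rightarrow> real" where
  "dyadic_limit x t w = lim (\<lambda>k. perc x (config (dyadic_floor k t) w))"

text \<open>Along the dyadic floors of \<open>t\<close> the indicator converges almost surely to
  \<open>dyadic_limit\<close>, and in L1 to its value at \<open>t\<close> by the linear bound in the
  time difference; the two limits agree almost surely.\<close>

lemma AE_eq_dyadic_limit:
  assumes x: "x \<in> V" and sum: "obs_influence (perc x) summable_on E" and t: "t \<in> {0..1}"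
  shows "AE w in M. perc x (config t w) = dyadic_limit x t w"
proof -
  note obs = observable_perc[OF x]
  have t0: "0 \<le> t" using t by simp
  note d = dyadic_floor_bounds[OF t0]
  note [measurable] = observable_config_measurable[OF obs t0]
    observable_config_measurable[OF obs d(1)]
  have [measurable]: "dyadic_limit x t \<in> borel_measurable M"
    unfolding dyadic_limit_def[abs_def] by measurable
  have conv: "AE w in M. (\<lambda>k. \<bar>perc x (config t w) - perc x (config (dyadic_floor k t) w)\<bar>)
      \<longlonglongrightarrow> \<bar>perc x (config t w) - dyadic_limit x t w\<bar>"
    using AE_dyadic_variation_bounded[OF obs locally_approximable_perc[OF x] sum, of 1]
  proof eventually_elim
    fix w assume "\<exists>K. \<forall>k. dyadic_variation (\<lambda>t. perc x (config t w)) 1 k \<le> K"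
    then obtain K where "\<And>k. dyadic_variation (\<lambda>t. perc x (config t w)) 1 k \<le> K" by blast
    from dyadic_limit_bounded_variation(1)[of "\<lambda>t. perc x (config t w)", OF this t]
    have "(\<lambda>k. perc x (config (dyadic_floor k t) w)) \<longlonglongrightarrow> dyadic_limit x t w"
      by (simp add: dyadic_limit_def convergent_LIMSEQ_iff)
    then show "(\<lambda>k. \<bar>perc x (config t w) - perc x (config (dyadic_floor k t) w)\<bar>)
      \<longlonglongrightarrow> \<bar>perc x (config t w) - dyadic_limit x t w\<bar>" by (intro tendsto_intros)
  qed
  have bnd: "AE w in M. norm \<bar>perc x (config t w) - perc x (config (dyadic_floor k t) w)\<bar> \<le> 1" for k
    by (simp add: perc_def)
  have int: "integrable M (\<lambda>w. \<bar>perc x (config t w) - dyadic_limit x t w\<bar>)"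
    by (rule integrable_dominated_convergence[where w="\<lambda>_. 1", OF _ _ _ conv bnd]) auto
  have lim: "(\<lambda>k. \<integral>w. \<bar>perc x (config t w) - perc x (config (dyadic_floor k t) w)\<bar> \<partial>M)
      \<longlonglongrightarrow> (\<integral>w. \<bar>perc x (config t w) - dyadic_limit x t w\<bar> \<partial>M)"
    by (rule integral_dominated_convergence[where w="\<lambda>_. 1", OF _ _ _ conv bnd]) auto
  have "(\<lambda>k. (t - dyadic_floor k t) * infsum (obs_influence (perc x)) E)
      \<longlonglongrightarrow> (t - t) * infsum (obs_influence (perc x)) E"
    by (intro tendsto_intros dyadic_floor_tendsto t0)
  then have "(\<integral>w. \<bar>perc x (config t w) - dyadic_limit x t w\<bar> \<partial>M)
      \<le> (t - t) * infsum (obs_influence (perc x)) E"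
    by (rule tendsto_le[OF sequentially_bot _ lim])
      (intro always_eventually allI config_dist_le obs locally_approximable_perc x sum d)
  moreover have "0 \<le> (\<integral>w. \<bar>perc x (config t w) - dyadic_limit x t w\<bar> \<partial>M)" by simp
  ultimately have "(\<integral>w. \<bar>perc x (config t w) - dyadic_limit x t w\<bar> \<partial>M) = 0" by simp
  then show ?thesis using integral_nonneg_eq_0_iff_AE[OF int] by simp
qed

text \<open>A jointly measurable version of \<open>X\<close>: it agrees with \<open>X\<close> on the paths of
  \<open>open_at_jumps\<close>, whereas \<open>X\<close> itself need not be jointly measurable.\<close>

definition edge_version :: "'v set \<Rightarrow> real \<times> 'w \<Rightarrow> bool" where
  "edge_version e z \<longleftrightarrow> (\<forall>n::nat. \<exists>q::rat. 0 \<le> q \<and> \<bar>of_rat q - fst z\<bar> < 1 / Suc n \<and> X e (of_rat q) (snd z))"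

lemma edge_version_sets:
  assumes "e \<in> E" shows "{z \<in> space (lborel \<Otimes>\<^sub>M M). edge_version e z} \<in> sets (lborel \<Otimes>\<^sub>M M)"
  unfolding edge_version_def
proof (intro sets.sets_Collect_countable_All sets.sets_Collect_countable_Ex)
  fix n :: nat and q :: rat
  show "{z \<in> space (lborel \<Otimes>\<^sub>M M). 0 \<le> q \<and> \<bar>of_rat q - fst z\<bar> < 1 / Suc n \<and> X e (of_rat q) (snd z)}
      \<in> sets (lborel \<Otimes>\<^sub>M M)"
  proof (cases "0 \<le> q")
    case True
    have [measurable]: "X e (of_rat q) \<in> measurable M (count_space UNIV)"
      using True by (intro edge_measurable assms) simp
    show ?thesis by measurable
  qed simp
qed

text \<open>At each fixed time the indicator almost surely equals its dyadic limit. Fubini exchanges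
  the quantifiers, almost surely equality at almost every time; this is applied to the version built
  from \<open>edge_version\<close>, which is jointly measurable.\<close>

theorem AE_equal_bounded_variation:
  assumes x: "x \<in> V" and sum: "obs_influence (perc x) summable_on E"
  shows "AE w in M. \<exists>g. bounded_variation_on 0 1 g \<and>
    (AE t in lebesgue_on {0..1}. of_bool (percolates E (\<lambda>e. X e t w) x) = g t)"
proof -
  interpret lb: pair_sigma_finite lborel M ..
  define perc_version where "perc_version z \<longleftrightarrow>
    (\<forall>C\<in>finite_sets_around V x. \<exists>e\<in>edge_boundary E C. edge_version e z)" for z
  have version: "perc_version (t, w) = percolates E (\<lambda>e. X e t w) x"
    if "\<forall>e\<in>E. open_at_jumps (\<lambda>t. X e t w)" "0 \<le> t" for t w
  proof -
    have "edge_version e (t, w) = X e t w" if "e \<in> E" for e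
      using open_at_jumps_iff_rational[of "\<lambda>t. X e t w" t] \<open>\<forall>e\<in>E. _ e\<close> \<open>0 \<le> t\<close> that
      by (simp add: edge_version_def)
    then show ?thesis
      unfolding perc_version_def percolates_iff_boundary[OF simple x]
      using edge_boundary_subset by (intro ball_cong bex_cong refl) blast
  qed
  have "{z \<in> space (lborel \<Otimes>\<^sub>M M). perc_version z} \<in> sets (lborel \<Otimes>\<^sub>M M)"
    unfolding perc_version_def using edge_boundary_subset
    by (intro sets.sets_Collect_countable_All' sets.sets_Collect_countable_Ex' edge_version_sets
        countable_finite_sets_around countable_finite[OF finite_edge_boundary]) blast
  then have [measurable]: "Measurable.pred (lborel \<Otimes>\<^sub>M M) perc_version"
    by (simp add: pred_def)
  have [measurable]: "(\<lambda>z. perc x (config (dyadic_floor k (fst z)) (snd z))) \<in> borel_measurable (lborel \<Otimes>\<^sub>M M)" for k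
    unfolding dyadic_floor_def
  \<comment> \<open>At a fixed level the dyadic floor takes countably many values, so joint
    measurability reduces to measurability at each fixed time.\<close>
  proof (rule measurable_compose_countable[where g="\<lambda>z. nat \<lfloor>fst z * 2 ^ k\<rfloor>"])
    fix i :: nat
    have [measurable]: "(\<lambda>w. perc x (config (real i / 2 ^ k) w)) \<in> borel_measurable M"
      by (rule observable_config_measurable[OF observable_perc[OF x]]) simp
    show "(\<lambda>z. perc x (config (real i / 2 ^ k) (snd z))) \<in> borel_measurable (lborel \<Otimes>\<^sub>M M)"
      by measurable
  qed measurable
  have [measurable]: "(\<lambda>z. dyadic_limit x (fst z) (snd z)) \<in> borel_measurable (lborel \<Otimes>\<^sub>M M)"
    unfolding dyadic_limit_def by measurable
  have "AE t in lborel. AE w in M. t \<in> {0..1} \<longrightarrow> of_bool (perc_version (t, w)) = dyadic_limit x t w"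
  proof (rule AE_I2)
    fix t :: real
    show "AE w in M. t \<in> {0..1} \<longrightarrow> of_bool (perc_version (t, w)) = dyadic_limit x t w"
    proof (cases "t \<in> {0..1}")
      case True
      show ?thesis
        using AE_eq_dyadic_limit[OF x sum True] AE_open_at_jumps
      proof eventually_elim
        fix w assume "perc x (config t w) = dyadic_limit x t w" "\<forall>e\<in>E. open_at_jumps (\<lambda>t. X e t w)"
        then show "t \<in> {0..1} \<longrightarrow> of_bool (perc_version (t, w)) = dyadic_limit x t w"
          using version[of w t] True by (simp only: config_def percolates_restrict perc_def atLeastAtMost_iff simp_thms)
      qed
    next
      case False
      then show ?thesis by (intro AE_I2) blast
    qed
  qed
  moreover have "{z \<in> space (lborel \<Otimes>\<^sub>M M). fst z \<in> {0..1} \<longrightarrow>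
      of_bool (perc_version (fst z, snd z)) = dyadic_limit x (fst z) (snd z)} \<in> sets (lborel \<Otimes>\<^sub>M M)"
    unfolding prod.collapse by measurable
  ultimately have "AE w in M. AE t in lborel. t \<in> {0..1} \<longrightarrow> of_bool (perc_version (t, w)) = dyadic_limit x t w"
    by (subst lb.AE_commute[symmetric]) auto
  then show ?thesis
    using AE_open_at_jumps
      AE_dyadic_variation_bounded[OF observable_perc[OF x] locally_approximable_perc[OF x] sum, of 1]
  proof eventually_elim
    fix w assume ae: "AE t in lborel. t \<in> {0..1} \<longrightarrow> of_bool (perc_version (t, w)) = dyadic_limit x t w"
      and jumps: "\<forall>e\<in>E. open_at_jumps (\<lambda>t. X e t w)"
      and "\<exists>K. \<forall>k. dyadic_variation (\<lambda>t. perc x (config t w)) 1 k \<le> K"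
    then obtain K where K: "\<And>k. dyadic_variation (\<lambda>t. perc x (config t w)) 1 k \<le> K" by blast
    have "bounded_variation_on 0 1 (\<lambda>t. dyadic_limit x t w)"
      unfolding dyadic_limit_def using K
      by (rule dyadic_limit_bounded_variation(2)[of "\<lambda>t. perc x (config t w)"])
    moreover have "AE t in lebesgue_on {0..1}. of_bool (percolates E (\<lambda>e. X e t w) x) = dyadic_limit x t w"
    proof -
      \<comment> \<open>On these paths the version agrees with the actual indicator at all times
        \<open>t \<ge> 0\<close>, so the version can be replaced before passing to the completed
        measure.\<close>
      have "AE t in lborel. t \<in> {0..1} \<longrightarrow> of_bool (percolates E (\<lambda>e. X e t w) x) = dyadic_limit x t w"
        using ae by eventually_elim (auto simp: version[OF jumps])
      then have "AE t in lebesgue. t \<in> {0..1} \<longrightarrow> of_bool (percolates E (\<lambda>e. X e t w) x) = dyadic_limit x t w"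
        by (rule AE_completion)
      then show ?thesis by (subst AE_restrict_space_iff) auto
    qed
    ultimately show "\<exists>g. bounded_variation_on 0 1 g \<and>
        (AE t in lebesgue_on {0..1}. of_bool (percolates E (\<lambda>e. X e t w) x) = g t)" by blast
  qed
qed

end

theorem theorem1p4:
  fixes V :: "'v set" and E :: "'v set set" and p :: "'v set \<Rightarrow> real"
    and M :: "'w measure" and X :: "'v set \<Rightarrow> real \<Rightarrow> 'w \<Rightarrow> bool" and x :: 'v and t\<^sub>0 :: real
  assumes "simple_graph V E" and "infinite V" and "connected_graph V E"
    and "locally_finite_graph V E"
    and "\<And>e. e \<in> E \<Longrightarrow> 0 < p e \<and> p e \<le> 1"
    and "dynamical_percolation M E p X"
    and "0 \<le> t\<^sub>0" and "AE \<omega> in M. \<exists>v\<in>V. percolates E (\<lambda>e. X e t\<^sub>0 \<omega>) v"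
    and "x \<in> V"
    and "(\<lambda>e. influence E p (percolation_event E p x) e) summable_on E"
  shows "(AE \<omega> in M. \<exists>g. bounded_variation_on 0 1 g \<and>
            (AE t in lebesgue_on {0..1}. of_bool (percolates E (\<lambda>e. X e t \<omega>) x) = g t)) \<and>
         (AE \<omega> in M. \<forall>t\<ge>0. \<exists>v\<in>V. percolates E (\<lambda>e. X e t \<omega>) v)"
proof -
  interpret M: prob_space M using assms(6) by (simp add: dynamical_percolation_def)
  interpret dynamical_percolation_graph V E p M X
    by unfold_locales (use assms in auto)
  have sum: "obs_influence (perc x) summable_on E"
    using assms(10) by (rule summable_on_cong[THEN iffD1, rotated]) (simp add: obs_influence_perc)
  show ?thesis
    using AE_equal_bounded_variation[OF assms(9) sum]
      no_exceptional_times[OF assms(9) sum percolation_prob_pos[OF assms(7-9)]] by blast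
qed

end
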